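(* Let $(\alpha,\beta)\in(0,1)^2$ satisfy $\gamma:=1+\alpha\beta-2\alpha>0$. If $\mathcal{C}=\{\mathcal{C}_k\}_{k=1}^\infty$ is $(\alpha,\beta)$-friendly, then the set $$\mathcal{X}_{\mathcal{C}}=\Big\{x\in\mathbb{R} : \Big\{k\in\mathbb{N} : x\in \bigcup_{n=-\infty}^{\infty} C_{k,n}\Big\}\text{ is finite}\Big\}$$ is $(\alpha,\beta)$-winning.
   Context: Schmidt's game on $\mathbb{R}$: for $\alpha,\beta\in(0,1)$ and $T\subset\mathbb{R}$, Bob first picks a closed interval $B_1$; then Alice picks a closed interval $A_1\subset B_1$ with radius $\rho(A_1)=\alpha\rho(B_1)$; Bob picks a closed interval $B_2\subset A_1$ with $\rho(B_2)=\beta\rho(A_1)$; Alice picks $A_2\subset B_2$ with $\rho(A_2)=\alpha\rho(B_2)$, and so on. $T$ is $(\alpha,\beta)$-winning if Alice can play so that $\bigcap_{n\ge1}B_n\subset T$. $\lambda$ denotes Lebesgue measure (length). Setup: $\mathcal{C}=\{\mathcal{C}_k\}_{k\ge1}$ where each $\mathcal{C}_k=\{C_{k,n}\}_{n\in\mathbb{Z}}$ is a sequence of finite, pairwise disjoint intervals, any two separated by a positive distance, with $C_{k,n-1}$ to the left of $C_{k,n}$; every bounded interval of $\mathbb{R}$ intersects only finitely many members of $\mathcal{C}_k$; and for every interval $I$ there is $K_I$ such that for all $k>K_I$, $I$ intersects at least two members of $\mathcal{C}_k$. $D_{k,n}$ denotes the interval between $C_{k,n-1}$ and $C_{k,n}$,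 and $\mathcal{D}_k=\{D_{k,n}\}_{n\in\mathbb{Z}}$. It is assumed that for all $k,n$, each $C_{k+1,n}$ and each $D_{k+1,n}$ is contained in some member of $\mathcal{C}_k$ or of $\mathcal{D}_k$. Put $\mathcal{V}_{k,n}=\{D_{k+1,m}: D_{k+1,m}\subset D_{k,n}\}$. $\mathcal{C}$ is $(\alpha,\beta)$-friendly if each member of $\mathcal{D}_k$ contains at least three members of $\mathcal{C}_{k+1}$ and there is an integer $K_{\mathcal{C}}$ such that for all $k>K_{\mathcal{C}}$, all integers $n$, and all $D\in\mathcal{V}_{k,n}$: $\lambda(D_{k,n})>\frac{1}{\alpha\beta\gamma}\max(\lambda(C_{k,n}),\lambda(C_{k,n+1}))$ and $\lambda(D)<\frac{(\alpha\beta)^2\gamma}{6}\min(\lambda(D_{k,n-1}),\lambda(D_{k,n}),\lambda(D_{k,n+1}))$, where $\gamma=1+\alpha\beta-2\alpha$. *)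

theory Defs
  imports "HOL-Analysis.Analysis"
begin

section \<open>Schmidt's game on the real line\<close>

text \<open>
  A closed interval of positive length is given by its midpoint and its radius.
\<close>

type_synonym ball = "real \<times> real"

definition interval_of :: "ball \<Rightarrow> real set" where
  "interval_of P = cball (fst P) (snd P)"

definition legal_move :: "real \<Rightarrow> ball \<Rightarrow> ball \<Rightarrow> bool" where
  "legal_move t P Q \<longleftrightarrow> interval_of Q \<subseteq> interval_of P \<and> snd Q = t * snd P"

text \<open>
  A strategy of Alice maps the nonempty list of the moves Bob has made so far to her answer.
  Bob's moves are numbered from 0, so \<^term>\<open>B 0\<close> is his opening interval.
\<close>

type_synonym strategy = "ball list \<Rightarrow> ball"

definition alice_move :: "strategy \<Rightarrow> (nat \<Rightarrow> ball) \<Rightarrow> nat \<Rightarrow> ball" where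
  "alice_move \<sigma> B n = \<sigma> (map B [0..<Suc n])"

definition bob_legal_upto :: "real \<Rightarrow> strategy \<Rightarrow> (nat \<Rightarrow> ball) \<Rightarrow> nat \<Rightarrow> bool" where
  "bob_legal_upto \<beta> \<sigma> B n \<longleftrightarrow>
     snd (B 0) > 0 \<and> (\<forall>i<n. legal_move \<beta> (alice_move \<sigma> B i) (B (Suc i)))"

text \<open>
  The first conjunct makes Alice answer legally after every legal finite play, so she cannot
  win by leaving Bob without a legal continuation.
\<close>

definition winning :: "real \<Rightarrow> real \<Rightarrow> real set \<Rightarrow> bool" where
  "winning \<alpha> \<beta> T \<longleftrightarrow>
     (\<exists>\<sigma>. (\<forall>B n. bob_legal_upto \<beta> \<sigma> B n \<longrightarrow> legal_move \<alpha> (B n) (alice_move \<sigma> B n)) \<and>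
          (\<forall>B. (\<forall>n. bob_legal_upto \<beta> \<sigma> B n) \<longrightarrow> (\<Inter>n. interval_of (B n)) \<subseteq> T))"


section \<open>Systems of intervals\<close>

text \<open>
  Only the levels \<open>k \<ge> 1\<close> of \<open>C k n\<close> are meaningful.  The interval between two consecutive
  members consists of all points strictly between them, so it contains exactly those endpoints
  that its neighbours do not.
\<close>

type_synonym interval_system = "nat \<Rightarrow> int \<Rightarrow> real set"

definition gap :: "interval_system \<Rightarrow> nat \<Rightarrow> int \<Rightarrow> real set" where
  "gap C k n = {x. (\<forall>y \<in> C k (n - 1). y < x) \<and> (\<forall>z \<in> C k n. x < z)}"

text \<open>
  In the condition on the number of members met by an interval, the interval must have
  nonempty interior: a single point cannot meet two disjoint sets.
\<close>

definition admissible_system :: "interval_system \<Rightarrow> bool" where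
  "admissible_system C \<longleftrightarrow>
     (\<forall>k\<ge>1. \<forall>n. is_interval (C k n) \<and> bounded (C k n) \<and> C k n \<noteq> {}) \<and>
     (\<forall>k\<ge>1. \<forall>m n. m \<noteq> n \<longrightarrow> C k m \<inter> C k n = {} \<and> setdist (C k m) (C k n) > 0) \<and>
     (\<forall>k\<ge>1. \<forall>n. \<forall>x \<in> C k (n - 1). \<forall>y \<in> C k n. x < y) \<and>
     (\<forall>k\<ge>1. \<forall>I. is_interval I \<and> bounded I \<longrightarrow> finite {n. C k n \<inter> I \<noteq> {}}) \<and>
     (\<forall>I. is_interval I \<and> interior I \<noteq> {} \<longrightarrow>
        (\<exists>K. \<forall>k>K. \<exists>m n. m \<noteq> n \<and> C k m \<inter> I \<noteq> {} \<and> C k n \<inter> I \<noteq> {})) \<and>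
     (\<forall>k\<ge>1. \<forall>n. \<exists>m. C (Suc k) n \<subseteq> C k m \<or> C (Suc k) n \<subseteq> gap C k m) \<and>
     (\<forall>k\<ge>1. \<forall>n. \<exists>m. gap C (Suc k) n \<subseteq> C k m \<or> gap C (Suc k) n \<subseteq> gap C k m)"

definition subgaps :: "interval_system \<Rightarrow> nat \<Rightarrow> int \<Rightarrow> real set set" where
  "subgaps C k n = {gap C (Suc k) m |m. gap C (Suc k) m \<subseteq> gap C k n}"

definition gam :: "real \<Rightarrow> real \<Rightarrow> real" where
  "gam \<alpha> \<beta> = 1 + \<alpha> * \<beta> - 2 * \<alpha>"

abbreviation len :: "real set \<Rightarrow> real" where
  "len \<equiv> measure lborel"

text \<open>
  For an admissible system the set of indices counted below is finite, and distinct indices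
  give distinct members.
\<close>

definition friendly :: "real \<Rightarrow> real \<Rightarrow> interval_system \<Rightarrow> bool" where
  "friendly \<alpha> \<beta> C \<longleftrightarrow>
     (\<forall>k\<ge>1. \<forall>n. card {m. C (Suc k) m \<subseteq> gap C k n} \<ge> 3) \<and>
     (\<exists>K::nat. \<forall>k>K. \<forall>n. \<forall>D \<in> subgaps C k n.
        len (gap C k n) > 1 / (\<alpha> * \<beta> * gam \<alpha> \<beta>) * max (len (C k n)) (len (C k (n + 1))) \<and>
        len D < (\<alpha> * \<beta>)\<^sup>2 * gam \<alpha> \<beta> / 6 *
          min (len (gap C k (n - 1))) (min (len (gap C k n)) (len (gap C k (n + 1)))))"

definition finitely_often :: "interval_system \<Rightarrow> real set" where
  "finitely_often C = {x. finite {k. k \<ge> 1 \<and> x \<in> (\<Union>n. C k n)}}"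

end

theory Submission
  imports Defs
begin

text \<open>
  Write \<open>y = \<alpha>\<beta>\<close> and \<open>\<gamma> = 1 + y - 2\<alpha>\<close>, so \<open>0 < \<gamma> < 1 - y\<close>.  By always playing as far to one side as
  possible, Alice moves the centre of Bob's interval (radius \<open>r\<close>) by at least \<open>\<gamma> r\<close> per round.
  She treats the levels one after another.  When Bob's interval has shrunk to the size of the
  gaps of level \<open>k\<close>, the bars \<open>C k n\<close> it meets are shorter than \<open>2\<gamma> r\<close>, so she can bring its centre
  beyond the bar in question; the gaps of level \<open>k + 1\<close> are so much smaller that she can go on pushing in
  the same direction until Bob's interval has left the bar.

  With the indexing of \<^const>\<open>gap\<close>, friendliness compares a bar only with the two gaps to its left.
  To the right of a bar of level \<open>k\<close> there may be a bar of level \<open>k + 1\<close> whose left gaps are hidden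
  in the first bar, then one of level \<open>k + 2\<close>, and so on; the lengths in such a chain decay geometrically.
  Alice therefore prefers the left side of a bar, and if she has to take the right side, she
  pushes right until the chain is behind her as well, possibly through several levels.
\<close>

section \<open>Ordered bars\<close>

text \<open>Levels up to \<open>K\<close> stay unconstrained: an admissible system gives
  \<open>K = 0\<close>, while the game is played above the threshold of friendliness.\<close>

locale ordered_bars =
  fixes lo hi :: "nat \<Rightarrow> int \<Rightarrow> real" and K :: nat
  assumes lo_le_hi: "K < k \<Longrightarrow> lo k i \<le> hi k i"
    and hi_less_lo: "K < k \<Longrightarrow> hi k i < lo k (i + 1)"
    and finite_lo: "K < k \<Longrightarrow> finite {i. p \<le> lo k i \<and> lo k i \<le> q}"
begin

lemma lo_mono:
  assumes "K < k" "i \<le> j" shows "lo k i \<le> lo k j"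
  using assms(2)
proof (induction rule: int_ge_induct)
  case (step j)
  then show ?case using lo_le_hi[OF assms(1), of j] hi_less_lo[OF assms(1), of j] by linarith
qed simp

lemma hi_mono:
  assumes "K < k" "i \<le> j" shows "hi k i \<le> hi k j"
  using assms(2)
proof (induction rule: int_ge_induct)
  case (step j)
  then show ?case using lo_le_hi[OF assms(1), of "j + 1"] hi_less_lo[OF assms(1), of j] by linarith
qed simp

lemma hi_less_lo': "K < k \<Longrightarrow> i < j \<Longrightarrow> hi k i < lo k j"
  using hi_less_lo[of k i] lo_mono[of k "i + 1" j] by linarith

lemma ex_hi_gt:
  assumes k: "K < k" shows "\<exists>i\<ge>i0. x < hi k i"
proof (rule ccontr)
  assume "\<not> ?thesis"
  then have "{i0..} \<subseteq> {i. lo k i0 \<le> lo k i \<and> lo k i \<le> x}"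
    using lo_mono[OF k] lo_le_hi[OF k] by (force simp: not_less intro: order_trans)
  then show False using finite_subset[OF _ finite_lo[OF k]] infinite_Ici by blast
qed

lemma ex_lo_less:
  assumes k: "K < k" shows "\<exists>i. lo k i < x"
proof (rule ccontr)
  assume "\<not> ?thesis"
  then have "{..0} \<subseteq> {i. x \<le> lo k i \<and> lo k i \<le> lo k 0}"
    using lo_mono[OF k] by (auto simp: not_less)
  then show False using finite_subset[OF _ finite_lo[OF k]] infinite_Iic by blast
qed

end

section \<open>The game on a tower of bars\<close>

text \<open>In the second case of \<open>child\<close> the size bounds come from the two gaps to the
  left of the abutting bar. The nearer one is hidden in bar \<open>i\<close>; the farther one is
  either hidden there too, which gives the factor 1/2, or lies in gap \<open>i - 1\<close>, which
  gives the bound by the gaps of level \<open>k\<close>.\<close>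

locale interval_tower = ordered_bars lo hi K
  for lo hi :: "nat \<Rightarrow> int \<Rightarrow> real" and K :: nat +
  fixes al y g :: real
  assumes y_pos: "0 < y" and y_less: "y < al" and al_less: "al < 1"
    and g_eq: "g = 1 + y - 2 * al" and g_pos: "0 < g"
    and bar_small: "K < k \<Longrightarrow> hi k i - lo k i < y * g * (lo k i - hi k (i - 1))"
    and subgap: "K < k \<Longrightarrow> hi k i \<le> hi (Suc k) n \<Longrightarrow> hi (Suc k) n < lo k (i + 1) \<Longrightarrow>
      lo (Suc k) (n + 1) \<le> lo k (i + 1) \<and>
      lo (Suc k) (n + 1) - hi (Suc k) n < y\<^sup>2 * g / 6 * (lo k i - hi k (i - 1)) \<and>
      lo (Suc k) (n + 1) - hi (Suc k) n < y\<^sup>2 * g / 6 * (lo k (i + 1) - hi k i) \<and>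
      lo (Suc k) (n + 1) - hi (Suc k) n < y\<^sup>2 * g / 6 * (lo k (i + 2) - hi k (i + 1))"
    and child: "K < k \<Longrightarrow> \<exists>m. hi k i \<le> hi (Suc k) m \<and> hi (Suc k) m < lo k (i + 1) \<and>
      ((lo k i \<le> lo (Suc k) m \<and> hi (Suc k) m = hi k i) \<or>
       (lo (Suc k) m = hi k i \<and>
        hi (Suc k) m - lo (Suc k) m \<le> y * g * (hi k i - lo k i) \<and>
        (hi (Suc k) m - lo (Suc k) m \<le> y * g / 2 * (hi k i - lo k i) \<or>
         (\<forall>t\<in>{i - 1, i}. hi (Suc k) m - lo (Suc k) m
            \<le> y * g * (y\<^sup>2 * g / 6 * (lo k (t + 1) - hi k t))))))"
begin

definition bar :: "nat \<Rightarrow> int \<Rightarrow> real" where "bar k i = hi k i - lo k i"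
text \<open>Gaps are indexed here by the bar on their left, so for a system \<open>C\<close> this is
  the length of \<open>gap C k (i + 1)\<close>.\<close>

definition gap_len :: "nat \<Rightarrow> int \<Rightarrow> real" where "gap_len k i = lo k (i + 1) - hi k i"

lemma g_less: "g < 1 - y"
  using g_eq y_less by linarith

lemma y_less_1: "y < 1" and g_less_1: "g < 1"
  using y_less al_less g_less y_pos by linarith+

lemma yg_le: "y * g \<le> 1 / 4"
proof -
  have "y * g \<le> y * (1 - y)"
    using g_less y_pos by (simp add: mult_left_mono)
  also have "\<dots> \<le> 1 / 4"
    using sum_squares_ge_zero[of "y - 1/2" 0] by (simp add: algebra_simps)
  finally show ?thesis .
qed

lemma yg_pos: "0 < y * g"
  using y_pos g_pos by simp

lemma y1g_less: "(1 + y) * g < 1"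
proof -
  have "(1 + y) * g \<le> (1 + y) * (1 - y)"
    using g_less y_pos by (intro mult_left_mono) auto
  also have "\<dots> < 1"
    using y_pos by (simp add: algebra_simps)
  finally show ?thesis .
qed

lemma y1yg_le: "(1 + y) * (y * g) \<le> 1 / 2"
  using mult_mono[of "1 + y" 2 "y * g" "1 / 4"] yg_le yg_pos y_less_1 y_pos by simp

lemma bar_nonneg: "K < k \<Longrightarrow> 0 \<le> bar k i"
  using lo_le_hi by (simp add: bar_def)

lemma gap_len_pos: "K < k \<Longrightarrow> 0 < gap_len k i"
  using hi_less_lo by (simp add: gap_len_def)

lemma bar_less: "K < k \<Longrightarrow> bar k i < y * g * gap_len k (i - 1)"
  using bar_small by (simp add: bar_def gap_len_def)

lemma subgap_gap_len:
  assumes "K < k" "hi k i \<le> hi (Suc k) n" "hi (Suc k) n < lo k (i + 1)" "t \<in> {i - 1, i, i + 1}"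
  shows "gap_len (Suc k) n < y\<^sup>2 * g / 6 * gap_len k t"
  using subgap[OF assms(1-3)] assms(4) by (auto simp: gap_len_def algebra_simps)

text \<open>The chain of later bars abutting bar \<open>i\<close> on its right, each with its left gap hidden inside
  the previous one, never extends beyond \<open>wall k i\<close>.\<close>

definition wall :: "nat \<Rightarrow> int \<Rightarrow> real" where
  "wall k i = hi k i + 3 / 5 * (y * g) * bar k i + g / 12 * gap_len k i"

definition edge :: "nat \<Rightarrow> int \<Rightarrow> real" where
  "edge k i = min (wall k i) (lo k (i + 1))"

lemma hi_less_wall: "K < k \<Longrightarrow> hi k i < wall k i"
  using bar_nonneg[of k i] gap_len_pos[of k i] g_pos y_pos by (simp add: wall_def add_nonneg_pos)

lemma hi_less_edge: "K < k \<Longrightarrow> hi k i < edge k i"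
  using hi_less_wall hi_less_lo by (simp add: edge_def)

text \<open>Bob's interval is right of bar \<open>i\<close> and its chain, or its centre is so far to the right that
  it will be after further moves to the right.  One such move leads from the second alternative
  to the third.\<close>

definition behind :: "nat \<Rightarrow> int \<Rightarrow> real \<Rightarrow> real \<Rightarrow> bool" where
  "behind k i c r \<longleftrightarrow> edge k i < c - r
     \<or> (hi k i + y / 2 * bar k i \<le> c \<and> y * bar k i < 2 * g * r)
     \<or> hi k i + y * bar k i \<le> c"

text \<open>The size conditions keep \<open>r\<close> from being too small for level
  \<open>k\<close>. A bar shorter than \<open>2 * g * r\<close> has an end that one push brings to
  the other side of the centre. A short gap nearby makes the gaps of level \<open>k + 1\<close>
  small against \<open>r\<close>; at a bar it must be one of the two adjoining gaps, since the last
  bound in \<open>child\<close> covers only these.\<close>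

definition sweeping :: "nat \<Rightarrow> int \<Rightarrow> real \<Rightarrow> real \<Rightarrow> bool" where
  "sweeping k i c r \<longleftrightarrow> behind k i c r
     \<and> (\<forall>j>i. lo k j \<le> c + r \<longrightarrow> c - r \<le> edge k j \<longrightarrow> bar k j < 2 * g * r)
     \<and> (\<forall>n\<ge>i. hi k n \<le> c + r \<longrightarrow> c - r \<le> lo k (n + 1) \<longrightarrow>
           (\<exists>t\<in>{n - 1, n, n + 1}. y * gap_len k t \<le> 2 * r))
     \<and> (\<forall>j>i. lo k j \<le> c + r \<longrightarrow> c - r \<le> hi k j \<longrightarrow> (\<exists>t\<in>{j - 1, j}. y * gap_len k t \<le> 2 * r))"

text \<open>The state after the first of two moves to the right past a bar that is the only one of
  its level met by Bob's interval.\<close>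

definition passing :: "nat \<Rightarrow> int \<Rightarrow> real \<Rightarrow> real \<Rightarrow> bool" where
  "passing k i c r \<longleftrightarrow> hi k i \<le> c \<and> y * bar k i < 2 * g * r \<and> c + r < lo k (i + 1)
     \<and> (\<exists>t\<in>{i - 1, i}. y\<^sup>2 * gap_len k t \<le> 2 * r)"

text \<open>Bob's interval meets bar \<open>i + 1\<close>, and Alice moves left until it lies inside gap \<open>i\<close>.  Each
  move leads from one of the three alternatives to the next; in all of them \<open>g * R \<le> r\<close>, which
  keeps \<open>r\<close> comparable with the gaps of the next level.\<close>

definition retreating :: "nat \<Rightarrow> int \<Rightarrow> real \<Rightarrow> real \<Rightarrow> real \<Rightarrow> bool" where
  "retreating k i R c r \<longleftrightarrow> 0 < R \<and> wall k i < c - r \<and> lo k (i + 1) \<le> c + r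
     \<and> (R \<le> y * r \<and> c \<le> lo k (i + 1) + g * r \<or> R \<le> r \<and> c \<le> lo k (i + 1)
        \<or> c \<le> lo k (i + 1) - g * R)
     \<and> (\<forall>n. hi k i \<le> hi (Suc k) n \<longrightarrow> hi (Suc k) n < lo k (i + 1) \<longrightarrow> gap_len (Suc k) n \<le> 2 * g * R)"

section \<open>Descent from a bar to its child\<close>

text \<open>All gaps of the new level that matter lie inside gap \<open>i\<close>, where
  \<open>b\<close> bounds them; each bar ahead is then small because of the gap to its left.\<close>

lemma level_up:
  assumes k: "K < k" and m: "hi k i \<le> hi (Suc k) m" and r: "0 < r" and right: "c + r < lo k (i + 1)"
    and b: "\<And>n. hi k i \<le> hi (Suc k) n \<Longrightarrow> hi (Suc k) n < lo k (i + 1) \<Longrightarrow> y * gap_len (Suc k) n \<le> 2 * r"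
    and behind: "behind (Suc k) m c r"
  shows "sweeping (Suc k) m c r"
proof -
  have k': "K < Suc k" using k by simp
  have gap: "y * gap_len (Suc k) n \<le> 2 * r" if "n \<ge> m" "hi (Suc k) n \<le> c + r" for n
    using b[of n] m hi_mono[OF k' that(1)] that(2) right by linarith
  have prev: "y * gap_len (Suc k) (j - 1) \<le> 2 * r" if "j > m" "lo (Suc k) j \<le> c + r" for j
    using gap[of "j - 1"] hi_less_lo'[OF k', of "j - 1" j] that by auto
  have "bar (Suc k) j < 2 * g * r" if "j > m" "lo (Suc k) j \<le> c + r" for j
  proof -
    have "bar (Suc k) j < g * (y * gap_len (Suc k) (j - 1))"
      using bar_less[OF k', of j] by (simp add: mult_ac)
    also have "\<dots> \<le> g * (2 * r)"
      using prev[OF that] g_pos by (intro mult_left_mono) auto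
    finally show ?thesis by simp
  qed
  then show ?thesis
    unfolding sweeping_def using behind gap prev by auto
qed

text \<open>The coefficients of \<open>wall\<close> are chosen for this induction. As
  \<open>u <= 1/4\<close>, an abutting child of length \<open>s'\<close> costs at most
  \<open>23/20 * s'\<close>. If \<open>s' <= u * s / 2\<close>, this fits into
  \<open>3/5 * u * s\<close>; if \<open>s' <= g * d / 24\<close>, it fits into
  \<open>g / 12 * d\<close> together with the term of the new gap, which is at most 1/24 of the old
  one.\<close>

lemma wall_child:
  assumes k: "K < k" and m1: "hi k i \<le> hi (Suc k) m" and m2: "hi (Suc k) m < lo k (i + 1)"
    and m: "(lo k i \<le> lo (Suc k) m \<and> hi (Suc k) m = hi k i) \<or>
       (lo (Suc k) m = hi k i \<and> (bar (Suc k) m \<le> y * g / 2 * bar k i \<or>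
         bar (Suc k) m \<le> y * g * (y\<^sup>2 * g / 6 * gap_len k i)))"
  shows "wall (Suc k) m \<le> wall k i"
proof -
  define s where "s = bar k i"
  define s' where "s' = bar (Suc k) m"
  define d where "d = gap_len k i"
  define u where "u = y * g"
  have u: "0 < u" "u \<le> 1 / 4" using yg_pos yg_le by (simp_all add: u_def)
  have nn: "0 \<le> s" "0 \<le> s'" "0 < d" using bar_nonneg gap_len_pos k by (simp_all add: s_def s'_def d_def)
  have yu: "y * u \<le> 1 / 4"
    using mult_mono[of y 1 u "1/4"] u y_less_1 by simp
  have d': "gap_len (Suc k) m \<le> (y * u) / 6 * d"
    using subgap_gap_len[OF k m1 m2, of i] by (simp add: d_def u_def power2_eq_square mult_ac)
  also have "\<dots> \<le> 1 / 24 * d" using yu nn by (intro mult_right_mono) (auto simp: mult_ac)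
  finally have d24: "gap_len (Suc k) m \<le> 1 / 24 * d" .
  have gd: "g * gap_len (Suc k) m \<le> g * (1 / 24 * d)"
    using d24 g_pos by (intro mult_left_mono) auto
  have us: "0 \<le> u * s" "0 \<le> g * d" using u nn g_pos by simp_all
  from m show ?thesis
  proof (elim disjE conjE)
    assume "lo k i \<le> lo (Suc k) m" "hi (Suc k) m = hi k i"
    then have "hi (Suc k) m = hi k i" "s' \<le> s" by (simp_all add: s_def s'_def bar_def)
    moreover from this have "u * s' \<le> u * s" using u by simp
    ultimately show ?thesis
      using gd us unfolding wall_def u_def[symmetric] s_def[symmetric] s'_def[symmetric] d_def[symmetric]
      by (simp add: mult.assoc)
  next
    assume lo: "lo (Suc k) m = hi k i" and "bar (Suc k) m \<le> y * g / 2 * bar k i"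
    then have a: "s' \<le> 1 / 2 * (u * s)" by (simp add: s_def s'_def u_def)
    have b: "u * s' \<le> 1 / 4 * s'" using u nn by (intro mult_right_mono) auto
    have "hi (Suc k) m = hi k i + s'" using lo by (simp add: s'_def bar_def)
    then show ?thesis
      using gd us a b unfolding wall_def u_def[symmetric] s_def[symmetric] s'_def[symmetric] d_def[symmetric]
      by (simp add: mult.assoc)
  next
    assume lo: "lo (Suc k) m = hi k i" and "bar (Suc k) m \<le> y * g * (y\<^sup>2 * g / 6 * gap_len k i)"
    then have "s' \<le> (y * u) * (y / 6) * (g * d)"
      by (simp add: s'_def u_def d_def power2_eq_square mult_ac)
    also have "\<dots> \<le> 1 / 4 * (1 / 6) * (g * d)"
      using yu u y_pos y_less_1 us by (intro mult_right_mono mult_mono) auto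
    finally have a: "s' \<le> 1 / 24 * (g * d)" by simp
    have b: "u * s' \<le> 1 / 4 * s'" using u nn by (intro mult_right_mono) auto
    have "hi (Suc k) m = hi k i + s'" using lo by (simp add: s'_def bar_def)
    then show ?thesis
      using gd us a b unfolding wall_def u_def[symmetric] s_def[symmetric] s'_def[symmetric] d_def[symmetric]
      by (simp add: mult.assoc)
  qed
qed

text \<open>The quantity \<open>hi + y * bar\<close> does not grow: an abutting child adds at most
  \<open>(1 + y) * (y * g * bar k i)\<close>, and \<open>(1 + y) * g < 1\<close>.\<close>

lemma obtain_child:
  assumes k: "K < k"
  obtains m where "hi k i \<le> hi (Suc k) m" "hi (Suc k) m < lo k (i + 1)"
    "wall (Suc k) m \<le> wall k i"
    "hi (Suc k) m + y * bar (Suc k) m \<le> hi k i + y * bar k i"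
    "hi (Suc k) m = hi k i \<or> hi (Suc k) m = hi k i + bar (Suc k) m \<and>
       (bar (Suc k) m \<le> y * g / 2 * bar k i \<or>
        (\<forall>t\<in>{i - 1, i}. bar (Suc k) m \<le> y * g * (y\<^sup>2 * g / 6 * gap_len k t)))"
proof -
  obtain m where m1: "hi k i \<le> hi (Suc k) m" and m2: "hi (Suc k) m < lo k (i + 1)"
    and m: "(lo k i \<le> lo (Suc k) m \<and> hi (Suc k) m = hi k i) \<or>
       (lo (Suc k) m = hi k i \<and> bar (Suc k) m \<le> y * g * bar k i \<and>
         (bar (Suc k) m \<le> y * g / 2 * bar k i \<or>
         (\<forall>t\<in>{i - 1, i}. bar (Suc k) m \<le> y * g * (y\<^sup>2 * g / 6 * gap_len k t))))"
    using child[OF k, of i] unfolding bar_def gap_len_def by blast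
  have "wall (Suc k) m \<le> wall k i"
    using wall_child[OF k m1 m2] m by auto
  moreover have "hi (Suc k) m + y * bar (Suc k) m \<le> hi k i + y * bar k i"
  proof (cases "lo k i \<le> lo (Suc k) m \<and> hi (Suc k) m = hi k i")
    case True
    then show ?thesis using y_pos by (simp add: bar_def)
  next
    case False
    then have lo: "lo (Suc k) m = hi k i" and b: "bar (Suc k) m \<le> y * g * bar k i"
      using m by auto
    have "(1 + y) * bar (Suc k) m \<le> (1 + y) * (y * g * bar k i)"
      using b y_pos by (intro mult_left_mono) auto
    also have "\<dots> = ((1 + y) * g) * (y * bar k i)" by (simp add: algebra_simps)
    also have "\<dots> \<le> 1 * (y * bar k i)"
      using y1g_less y_pos bar_nonneg[OF k] by (intro mult_right_mono) auto
    finally show ?thesis using lo by (simp add: bar_def algebra_simps)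
  qed
  moreover have "hi (Suc k) m = hi k i \<or> hi (Suc k) m = hi k i + bar (Suc k) m \<and>
       (bar (Suc k) m \<le> y * g / 2 * bar k i \<or>
        (\<forall>t\<in>{i - 1, i}. bar (Suc k) m \<le> y * g * (y\<^sup>2 * g / 6 * gap_len k t)))"
    using m by (auto simp: bar_def)
  ultimately show ?thesis using that m1 m2 by blast
qed


section \<open>Single rounds in terms of centres\<close>

text \<open>Alice's interval has radius \<open>al * r\<close> and Bob's next one
  \<open>y * r\<close>, so their centres can move by at most \<open>(1 - al) * r\<close> and
  \<open>(al - y) * r\<close>.\<close>

definition forces :: "real \<Rightarrow> real \<Rightarrow> (real \<Rightarrow> bool) \<Rightarrow> bool" where
  "forces c r Q \<longleftrightarrow> (\<exists>p. \<bar>p - c\<bar> \<le> (1 - al) * r \<and> (\<forall>c'. \<bar>c' - p\<bar> \<le> (al - y) * r \<longrightarrow> Q c'))"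

text \<open>This is the origin of \<open>g\<close>: Alice shifts the centre by
  \<open>(1 - al) * r\<close>, Bob can take back at most \<open>(al - y) * r\<close>, and the
  difference is \<open>g * r\<close>.\<close>

lemma push_right:
  assumes "0 < r"
    and Q: "\<And>c'. c + g * r \<le> c' \<Longrightarrow> c - r \<le> c' - y * r \<Longrightarrow> c' + y * r \<le> c + r \<Longrightarrow> Q c'"
  shows "forces c r Q"
  unfolding forces_def
proof (intro exI[of _ "c + (1 - al) * r"] conjI allI impI)
  show "\<bar>c + (1 - al) * r - c\<bar> \<le> (1 - al) * r" using assms(1) al_less by simp
  fix c' assume "\<bar>c' - (c + (1 - al) * r)\<bar> \<le> (al - y) * r"
  then have "c + g * r \<le> c'" "c' + y * r \<le> c + r"
    unfolding g_eq abs_le_iff by (simp_all add: algebra_simps)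
  moreover have "y * r \<le> r" "0 \<le> g * r" using assms(1) y_less_1 g_pos by simp_all
  ultimately show "Q c'" using Q by auto
qed

lemma push_left:
  assumes "0 < r"
    and Q: "\<And>c'. c' \<le> c - g * r \<Longrightarrow> c - r \<le> c' - y * r \<Longrightarrow> c' + y * r \<le> c + r \<Longrightarrow> Q c'"
  shows "forces c r Q"
  unfolding forces_def
proof (intro exI[of _ "c - (1 - al) * r"] conjI allI impI)
  show "\<bar>c - (1 - al) * r - c\<bar> \<le> (1 - al) * r" using assms(1) al_less by simp
  fix c' assume "\<bar>c' - (c - (1 - al) * r)\<bar> \<le> (al - y) * r"
  then have "c' \<le> c - g * r" "c - r \<le> c' - y * r"
    unfolding g_eq abs_le_iff by (simp_all add: algebra_simps)
  moreover have "y * r \<le> r" "0 \<le> g * r" using assms(1) y_less_1 g_pos by simp_all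
  ultimately show "Q c'" using Q by auto
qed

text \<open>Alice's interval has length \<open>2 * al * r\<close>, so it fits strictly between
  \<open>p\<close> and \<open>q\<close> when centred there, and Bob must stay inside it.\<close>

lemma place_between:
  assumes "p + 2 * al * r < q" "c - r \<le> p" "q \<le> c + r"
    and Q: "\<And>c'. p < c' - y * r \<Longrightarrow> c' + y * r < q \<Longrightarrow> Q c'"
  shows "forces c r Q"
  unfolding forces_def
proof (intro exI[of _ "(p + q) / 2"] conjI allI impI)
  show "\<bar>(p + q) / 2 - c\<bar> \<le> (1 - al) * r"
    unfolding abs_le_iff using assms(1-3) by (simp add: field_simps)
  fix c' assume "\<bar>c' - (p + q) / 2\<bar> \<le> (al - y) * r"
  then show "Q c'"
    unfolding abs_le_iff using assms(1) by (intro Q) (simp_all add: field_simps)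
qed

text \<open>The number \<open>N\<close> counts the progress through the levels.  The limit point of the play will be
  greater than \<open>v\<close>: by \<open>Tr\<close>, Alice keeps moving right as long as \<open>v\<close> belongs to Bob's interval.\<close>

definition Inv :: "nat \<Rightarrow> real \<Rightarrow> real \<Rightarrow> real \<Rightarrow> bool" where
  "Inv N v c r \<longleftrightarrow> 0 < r \<and>
     ((\<exists>k i. N = 2 * k \<and> K < k \<and> v \<le> hi k i \<and> sweeping k i c r) \<or>
      (\<exists>k i R. N = 2 * k \<and> K < k \<and> v \<le> hi k i \<and> retreating k i R c r) \<or>
      (\<exists>k i. N = 2 * k + 1 \<and> K < k \<and> v \<le> hi k i \<and> passing k i c r))"

text \<open>A stage \<open>N\<close> cannot last forever, because it lasts only while Bob's interval is at least
  half as long as certain gaps of the next level.\<close>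

definition stuck :: "nat \<Rightarrow> int \<Rightarrow> real \<Rightarrow> real \<Rightarrow> bool" where
  "stuck k j c r \<longleftrightarrow> c - r \<le> lo k (j + 1) \<and> lo k (j + 1) \<le> c + r \<and>
     (\<forall>n. hi k j \<le> hi (Suc k) n \<longrightarrow> hi (Suc k) n < lo k (j + 1) \<longrightarrow> gap_len (Suc k) n \<le> 2 * r)"

text \<open>Level \<open>k\<close> is settled when the stage passes \<open>2 * k\<close>: each of
  its bars then lies left of the new bound \<open>v'\<close> or misses Bob's next interval. The last
  conjunct lets a stage persist only while Bob's interval is \<open>stuck\<close>; odd stages last
  one round.\<close>

definition Tr :: "nat \<Rightarrow> real \<Rightarrow> real \<Rightarrow> real \<Rightarrow> nat \<Rightarrow> real \<Rightarrow> real \<Rightarrow> bool" where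
  "Tr N v c r N' v' c' \<longleftrightarrow> N \<le> N' \<and>
     (v < c' - y * r \<or> v \<le> v' \<and> c + g * r \<le> c') \<and>
     (\<forall>k l. N \<le> 2 * k \<longrightarrow> 2 * k < N' \<longrightarrow> hi k l \<le> v' \<or> c' + y * r < lo k l \<or> hi k l < c' - y * r) \<and>
     (N' = N \<longrightarrow> (\<exists>k j. N = 2 * k \<and> stuck k j c r))"

section \<open>Restoring the invariant after a round\<close>

definition reply :: "nat \<Rightarrow> real \<Rightarrow> real \<Rightarrow> real \<Rightarrow> real \<Rightarrow> bool" where
  "reply N v c r c' \<longleftrightarrow> (\<exists>N' v'. Inv N' v' c' (y * r) \<and> Tr N v c r N' v' c')"

lemma reply_sweeping:
  assumes "K < k" "0 < r" "v \<le> hi k i" "sweeping k i c' (y * r)" "c + g * r \<le> c'" "stuck k j c r"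
  shows "reply (2 * k) v c r c'"
  unfolding reply_def
  by (rule exI[of _ "2 * k"], rule exI[of _ "hi k i"])
     (use assms y_pos in \<open>auto simp: Inv_def Tr_def\<close>)

lemma reply_up:
  assumes "K < k" "0 < r" "sweeping (Suc k) m c' (y * r)"
    "v < c' - y * r \<or> v \<le> hi (Suc k) m \<and> c + g * r \<le> c'"
    "\<And>l. hi k l \<le> hi (Suc k) m \<or> c' + y * r < lo k l \<or> hi k l < c' - y * r"
  shows "reply (2 * k) v c r c'"
  unfolding reply_def
proof (intro exI conjI)
  show "Inv (2 * Suc k) (hi (Suc k) m) c' (y * r)"
    unfolding Inv_def using assms(1-3) y_pos
    by (intro conjI disjI1 exI[of _ "Suc k"] exI[of _ m]) auto
  have lvl: "k' = k" if "k \<le> k'" "k' < Suc k" for k' using that by simp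
  show "Tr (2 * k) v c r (2 * Suc k) (hi (Suc k) m) c'"
    unfolding Tr_def using assms(4,5) by (auto simp del: mult_Suc_right dest!: lvl)
qed

lemma reply_up_passing:
  assumes "K < k" "0 < r" "sweeping (Suc k) m c' (y * r)" "v \<le> hi (Suc k) m" "c + g * r \<le> c'"
  shows "reply (2 * k + 1) v c r c'"
  unfolding reply_def
proof (intro exI conjI)
  show "Inv (2 * Suc k) (hi (Suc k) m) c' (y * r)"
    unfolding Inv_def using assms(1-3) y_pos
    by (intro conjI disjI1 exI[of _ "Suc k"] exI[of _ m]) auto
  \<comment> \<open>Level \<open>k\<close> was settled on entering the odd stage, so no level is
    left to check here.\<close>
  have "\<not> (2 * k + 1 \<le> 2 * k' \<and> 2 * k' < 2 * Suc k)" for k' :: nat by presburger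
  then show "Tr (2 * k + 1) v c r (2 * Suc k) (hi (Suc k) m) c'"
    unfolding Tr_def using assms(4,5) by auto
qed

lemma reply_passing:
  assumes "K < k" "0 < r" "passing k i c' (y * r)" "v \<le> hi k i" "c + g * r \<le> c'"
  shows "reply (2 * k) v c r c'"
  unfolding reply_def
proof (intro exI conjI)
  show "Inv (2 * k + 1) (hi k i) c' (y * r)"
    unfolding Inv_def using assms(1-3) y_pos by auto
  have lvl: "k' = k" if "k \<le> k'" "2 * k' < Suc (2 * k)" for k' using that by linarith
  have "hi k l \<le> hi k i \<or> c' + y * r < lo k l" for l
    using hi_mono[OF assms(1), of l i] lo_mono[OF assms(1), of "i + 1" l] assms(3)
    unfolding passing_def by (cases "l \<le> i") force+
  then show "Tr (2 * k) v c r (2 * k + 1) (hi k i) c'"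
    unfolding Tr_def using assms(4,5) by (auto dest!: lvl)
qed

text \<open>Either Bob's interval still meets bar \<open>i + 1\<close> and the retreat goes on, or
  it lies in gap \<open>i\<close> beyond \<open>wall k i\<close>, hence beyond the wall of the
  child, and level \<open>k + 1\<close> begins.\<close>

lemma reply_retreating:
  assumes k: "K < k" and r: "0 < r" and R: "0 < R" and v: "v \<le> hi k i" and wall: "wall k i < c' - y * r"
    and size: "y * g * R \<le> y * r"
    and phase: "R \<le> y * (y * r) \<and> c' \<le> lo k (i + 1) + g * (y * r) \<or> R \<le> y * r \<and> c' \<le> lo k (i + 1)
        \<or> c' \<le> lo k (i + 1) - g * R"
    and sub: "\<And>n. hi k i \<le> hi (Suc k) n \<Longrightarrow> hi (Suc k) n < lo k (i + 1) \<Longrightarrow> gap_len (Suc k) n \<le> 2 * g * R"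
    and stuck: "stuck k i c r"
  shows "reply (2 * k) v c r c'"
proof (cases "lo k (i + 1) \<le> c' + y * r")
  case True
  then have L: "retreating k i R c' (y * r)"
    unfolding retreating_def using R wall phase sub by blast
  show ?thesis
    unfolding reply_def
  proof (intro exI conjI)
    show "Inv (2 * k) (hi k i) c' (y * r)" unfolding Inv_def using L k r y_pos by auto
    show "Tr (2 * k) v c r (2 * k) (hi k i) c'"
      unfolding Tr_def using v wall hi_less_wall[OF k, of i] stuck by auto
  qed
next
  case False
  obtain m where m: "hi k i \<le> hi (Suc k) m" "wall (Suc k) m \<le> wall k i"
    using obtain_child[OF k, of i] by blast
  have "behind (Suc k) m c' (y * r)"
    unfolding behind_def edge_def using m wall by auto
  moreover have "y * gap_len (Suc k) n \<le> 2 * (y * r)"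
    if "hi k i \<le> hi (Suc k) n" "hi (Suc k) n < lo k (i + 1)" for n
    using mult_left_mono[OF sub[OF that], of y] y_pos size by (simp add: mult_ac)
  ultimately have "sweeping (Suc k) m c' (y * r)"
    using level_up[OF k m(1), of "y * r" c'] False y_pos r by auto
  then show ?thesis
  proof (rule reply_up[OF k r])
    show "v < c' - y * r \<or> v \<le> hi (Suc k) m \<and> c + g * r \<le> c'"
      using v wall hi_less_wall[OF k, of i] by auto
    show "hi k l \<le> hi (Suc k) m \<or> c' + y * r < lo k l \<or> hi k l < c' - y * r" for l
      using hi_mono[OF k, of l i] lo_mono[OF k, of "i + 1" l] False m(1) by (cases "l \<le> i") auto
  qed
qed

section \<open>Rounds of retreating and passing\<close>

text \<open>A push left by \<open>g * r\<close> advances the alternatives of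
  \<open>retreating\<close>. In the last one, \<open>lo k (i + 1) <= c + r\<close> forces
  \<open>g * R <= r\<close>, so the interval gets free of bar \<open>i + 1\<close> before it becomes
  too small for the next level.\<close>

lemma step_retreating:
  assumes k: "K < k" and r: "0 < r" and v: "v \<le> hi k i" and L: "retreating k i R c r"
  shows "forces c r (reply (2 * k) v c r)"
proof (rule push_left[OF r])
  fix c' assume c': "c' \<le> c - g * r" "c - r \<le> c' - y * r"
  have R: "0 < R" and wall: "wall k i < c - r" and meet: "lo k (i + 1) \<le> c + r"
    and phase: "R \<le> y * r \<and> c \<le> lo k (i + 1) + g * r \<or> R \<le> r \<and> c \<le> lo k (i + 1)
        \<or> c \<le> lo k (i + 1) - g * R"
    and sub: "\<And>n. hi k i \<le> hi (Suc k) n \<Longrightarrow> hi (Suc k) n < lo k (i + 1) \<Longrightarrow> gap_len (Suc k) n \<le> 2 * g * R"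
    using L unfolding retreating_def by auto
  have yr: "y * r \<le> r" "0 \<le> g * r" "g * r \<le> r" "0 < g * R" "g * R \<le> R"
    using y_less_1 r y_pos g_pos g_less_1 R by simp_all
  have gR: "g * R \<le> r" using phase meet yr by linarith
  have phase': "R \<le> y * (y * r) \<and> c' \<le> lo k (i + 1) + g * (y * r) \<or>
      R \<le> y * r \<and> c' \<le> lo k (i + 1) \<or> c' \<le> lo k (i + 1) - g * R"
    using phase
  proof (elim disjE conjE)
    assume "R \<le> r" "c \<le> lo k (i + 1)"
    then have "g * R \<le> g * r" "c \<le> lo k (i + 1)" using g_pos by auto
    then show ?thesis using c' by linarith
  qed (use c' yr in linarith)+
  have "c - r \<le> lo k (i + 1)" using phase yr r by linarith
  then have "stuck k i c r"
    unfolding stuck_def using meet sub gR by fastforce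
  then show "reply (2 * k) v c r c'"
    using reply_retreating[OF k r R v _ _ phase' sub] wall c' gR y_pos by (simp add: mult.assoc)
qed


text \<open>The second push puts the centre at least \<open>g * r\<close> beyond
  \<open>hi k i\<close>. It therefore suffices to find a bar of level \<open>k + 1\<close> for which
  \<open>hi + y * bar\<close> exceeds \<open>hi k i\<close> by at most \<open>g * r\<close>.\<close>

lemma step_passing:
  assumes k: "K < k" and r: "0 < r" and v: "v \<le> hi k i" and P: "passing k i c r"
  shows "forces c r (reply (2 * k + 1) v c r)"
proof (rule push_right[OF r])
  fix c' assume c': "c + g * r \<le> c'" "c' + y * r \<le> c + r"
  have k': "K < Suc k" using k by simp
  have c: "hi k i \<le> c" and bar: "y * bar k i < 2 * g * r" and right: "c + r < lo k (i + 1)"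
    using P unfolding passing_def by auto
  obtain t where t: "t \<in> {i - 1, i}" and Gt: "y\<^sup>2 * gap_len k t \<le> 2 * r"
    using P unfolding passing_def by auto
  have Gt': "y\<^sup>2 * g / 6 * gap_len k t \<le> g * r / 3"
    using mult_left_mono[OF Gt, of "g / 6"] g_pos by (simp add: mult_ac)
  have sub: "gap_len (Suc k) n \<le> g * r / 3" if "hi k i \<le> hi (Suc k) n" "hi (Suc k) n < lo k (i + 1)" for n
  proof -
    have "t \<in> {i - 1, i, i + 1}" using t by auto
    from subgap_gap_len[OF k that this] Gt' show ?thesis by linarith
  qed
  have gr: "0 < g * r" "g * r \<le> r" using g_pos g_less_1 r by simp_all
  have sub': "y * gap_len (Suc k) n \<le> 2 * (y * r)"
    if "hi k i \<le> hi (Suc k) n" "hi (Suc k) n < lo k (i + 1)" for n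
  proof -
    have "gap_len (Suc k) n \<le> 2 * r" using sub[OF that] gr by linarith
    then have "y * gap_len (Suc k) n \<le> y * (2 * r)" using y_pos by (intro mult_left_mono) auto
    then show ?thesis by (simp add: mult_ac)
  qed
  have finish: "reply (2 * k + 1) v c r c'"
    if m: "hi k i \<le> hi (Suc k) m" and le: "hi (Suc k) m + y * bar (Suc k) m \<le> hi k i + g * r" for m
  proof -
    have "behind (Suc k) m c' (y * r)"
      unfolding behind_def using le c c' by linarith
    then have "sweeping (Suc k) m c' (y * r)"
      using level_up[OF k m, of "y * r" c'] sub' c' right r y_pos by auto
    then show ?thesis
      using reply_up_passing[OF k r] v m c' by auto
  qed
  obtain m where m: "hi k i \<le> hi (Suc k) m" "hi (Suc k) m < lo k (i + 1)"
    and m_cases: "hi (Suc k) m = hi k i \<or> hi (Suc k) m = hi k i + bar (Suc k) m \<and>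
       (bar (Suc k) m \<le> y * g / 2 * bar k i \<or>
        (\<forall>t\<in>{i - 1, i}. bar (Suc k) m \<le> y * g * (y\<^sup>2 * g / 6 * gap_len k t)))"
    using obtain_child[OF k, of i] by metis
  show "reply (2 * k + 1) v c r c'"
    using m_cases
  proof (elim disjE conjE)
    \<comment> \<open>A child inside bar \<open>i\<close> may be as long as bar \<open>i\<close>,
      too long for the required estimate. Bar \<open>m + 1\<close> is controlled by the short gap
      before it and serves instead.\<close>
    assume eq: "hi (Suc k) m = hi k i"
    have "(1 + y) * bar (Suc k) (m + 1) \<le> (1 + y) * (y * g * gap_len (Suc k) m)"
      using bar_less[OF k', of "m + 1"] y_pos by (intro mult_left_mono) auto
    also have "\<dots> = ((1 + y) * (y * g)) * gap_len (Suc k) m" by simp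
    also have "\<dots> \<le> 1 / 2 * gap_len (Suc k) m"
      using y1yg_le gap_len_pos[OF k', of m] by (intro mult_right_mono) auto
    finally have "(1 + y) * bar (Suc k) (m + 1) \<le> 1 / 2 * gap_len (Suc k) m" .
    moreover have "hi (Suc k) (m + 1) = hi k i + gap_len (Suc k) m + bar (Suc k) (m + 1)"
      by (simp add: gap_len_def bar_def eq)
    ultimately have "hi (Suc k) (m + 1) + y * bar (Suc k) (m + 1) \<le> hi k i + g * r"
      using sub[OF m] gr by (simp add: algebra_simps)
    then show ?thesis
      using hi_mono[OF k', of m "m + 1"] m(1) by (intro finish[of "m + 1"]) auto
  next
    assume eq: "hi (Suc k) m = hi k i + bar (Suc k) m" and b: "bar (Suc k) m \<le> y * g / 2 * bar k i"
    have "y * g / 2 * bar k i \<le> g * (g * r)"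
      using mult_left_mono[OF less_imp_le[OF bar], of "g / 2"] g_pos by (simp add: mult_ac)
    then have "(1 + y) * bar (Suc k) m \<le> (1 + y) * (g * (g * r))"
      using b y_pos by (intro mult_left_mono) auto
    also have "\<dots> = ((1 + y) * g) * (g * r)" by simp
    also have "\<dots> \<le> 1 * (g * r)" using y1g_less gr by (intro mult_right_mono) auto
    finally show ?thesis using eq by (intro finish[OF m(1)]) (simp add: algebra_simps)
  next
    assume eq: "hi (Suc k) m = hi k i + bar (Suc k) m"
      and b: "\<forall>t\<in>{i - 1, i}. bar (Suc k) m \<le> y * g * (y\<^sup>2 * g / 6 * gap_len k t)"
    have "bar (Suc k) m \<le> y * g * (y\<^sup>2 * g / 6 * gap_len k t)" using b t by blast
    also have "\<dots> \<le> y * g * (g * r / 3)" using Gt' yg_pos by (intro mult_left_mono) auto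
    finally have "(1 + y) * bar (Suc k) m \<le> (1 + y) * (y * g * (g * r / 3))"
      using y_pos by (intro mult_left_mono) auto
    also have "\<dots> = ((1 + y) * (y * g)) * (g * r / 3)" by simp
    also have "\<dots> \<le> 1 / 2 * (g * r / 3)" using y1yg_le gr by (intro mult_right_mono) auto
    finally show ?thesis using eq gr by (intro finish[OF m(1)]) (simp add: algebra_simps)
  qed
qed

text \<open>If Bob's interval is too large for Alice to fit between the wall of bar \<open>i\<close> and bar
  \<open>i + 1\<close> although gap \<open>i\<close> is longer than it, then bar \<open>i\<close> is so long that
  bar \<open>i + 1\<close> has been left behind together with it.\<close>

lemma fits_or_behind:
  assumes k: "K < k" and r: "0 < r" and G: "2 * r < gap_len k i"
    and beh: "(hi k i + y / 2 * bar k i \<le> c \<and> y * bar k i < 2 * g * r) \<or> hi k i + y * bar k i \<le> c"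
    and no: "\<not> behind k (i + 1) c r"
  shows "wall k i + 2 * al * r < lo k (i + 1)"
proof (rule ccontr)
  define s where "s = bar k i"
  define d where "d = gap_len k i"
  assume "\<not> ?thesis"
  then have "d \<le> 3 / 5 * (y * g) * s + g / 12 * d + 2 * al * r"
    unfolding wall_def s_def d_def gap_len_def by linarith
  moreover have "al * (2 * r) \<le> al * d"
    using G y_pos y_less by (intro mult_left_mono) (auto simp: d_def)
  moreover have d0: "0 < d" "0 \<le> s" using G r bar_nonneg[OF k] by (auto simp: d_def s_def)
  moreover have "g * d \<le> (1 - al) * d"
    using g_eq y_less d0 by (intro mult_right_mono) auto
  \<comment> \<open>Replacing \<open>2 * r\<close> by the larger \<open>d\<close> leaves
    \<open>(1 - al) * d\<close> on the left, which is at least \<open>g * d\<close>; the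
    \<open>g / 12 * d\<close> of the wall is then subtracted.\<close>
  ultimately have "11 / 12 * (g * d) \<le> 3 / 5 * (g * (y * s))" by (simp add: algebra_simps)
  then have "g * (11 / 12 * d) \<le> g * (3 / 5 * (y * s))" by simp
  then have ds: "11 / 12 * d \<le> 3 / 5 * (y * s)"
    using mult_le_cancel_left_pos[OF g_pos] by blast
  have "\<not> y * s < 2 * g * r"
  proof
    assume a: "y * s < 2 * g * r"
    have "g * r \<le> r" using g_less_1 r by simp
    then show False using a ds G r unfolding d_def[symmetric] mult.assoc by linarith
  qed
  then have c: "hi k i + y * s \<le> c" using beh by (auto simp: s_def)
  have "(1 + y) * bar k (i + 1) \<le> (1 + y) * (y * g * d)"
    using bar_less[OF k, of "i + 1"] y_pos by (intro mult_left_mono) (auto simp: d_def)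
  also have "\<dots> = ((1 + y) * (y * g)) * d" by simp
  also have "\<dots> \<le> 1 / 2 * d" using y1yg_le d0 by (intro mult_right_mono) auto
  finally have "(1 + y) * bar k (i + 1) \<le> 1 / 2 * d" .
  moreover have "hi k (i + 1) = hi k i + d + bar k (i + 1)" by (simp add: d_def gap_len_def bar_def)
  moreover have "0 \<le> y * s" using d0 y_pos by simp
  ultimately have "hi k (i + 1) + y * bar k (i + 1) \<le> c"
    using c ds by (simp add: algebra_simps)
  then show False using no unfolding behind_def by blast
qed


section \<open>Rounds of sweeping\<close>

lemma behind_hi:
  assumes "K < k" "0 < r" "behind k i c r" shows "hi k i \<le> c"
proof -
  have "0 \<le> y * bar k i" using bar_nonneg[OF assms(1)] y_pos by simp
  then show ?thesis using assms(2,3) hi_less_edge[OF assms(1), of i] unfolding behind_def by auto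
qed

lemma subgap_small:
  assumes k: "K < k" and n: "hi k i \<le> hi (Suc k) n" "hi (Suc k) n < lo k (i + 1)"
    and t: "t \<in> {i - 1, i, i + 1}" and Gt: "y * gap_len k t \<le> 2 * r"
  shows "y * gap_len (Suc k) n \<le> 2 * (y * r)"
proof -
  have "gap_len (Suc k) n \<le> y * g / 6 * (y * gap_len k t)"
    using subgap_gap_len[OF k n t] by (simp add: power2_eq_square mult_ac)
  also have "\<dots> \<le> 1 * (2 * r)"
  proof (rule mult_mono[OF _ Gt])
    show "0 \<le> y * gap_len k t" using y_pos gap_len_pos[OF k, of t] by simp
  qed (use yg_le in auto)
  finally have "gap_len (Suc k) n \<le> 2 * r" by simp
  then have "y * gap_len (Suc k) n \<le> y * (2 * r)" using y_pos by (intro mult_left_mono) auto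
  then show ?thesis by (simp add: mult_ac)
qed

text \<open>With no bar ahead inside Bob's interval, level \<open>k\<close> is done. Each
  alternative of \<open>behind\<close> passes to the child: walls do not grow, and in the second
  alternative the gain \<open>g * r\<close> supplies the missing half of
  \<open>y * bar k i\<close>.\<close>

lemma step_sweeping_ahead:
  assumes k: "K < k" and r: "0 < r" and v: "v \<le> hi k i" and S: "sweeping k i c r"
    and ahead: "c + r < lo k (i + 1)"
  shows "forces c r (reply (2 * k) v c r)"
proof (rule push_right[OF r])
  fix c' assume c': "c + g * r \<le> c'" "c - r \<le> c' - y * r" "c' + y * r \<le> c + r"
  have beh: "behind k i c r" using S unfolding sweeping_def by blast
  have yr: "0 < y * r" "0 < g * r" using y_pos g_pos r by auto
  have "hi k i \<le> c + r" using behind_hi[OF k r beh] r by linarith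
  then obtain t where t: "t \<in> {i - 1, i, i + 1}" and Gt: "y * gap_len k t \<le> 2 * r"
    using S ahead r unfolding sweeping_def by force
  note sub = subgap_small[OF k _ _ t Gt]
  obtain m where m: "hi k i \<le> hi (Suc k) m" "wall (Suc k) m \<le> wall k i"
    and child: "hi (Suc k) m + y * bar (Suc k) m \<le> hi k i + y * bar k i"
    using obtain_child[OF k, of i] by blast
  have "behind (Suc k) m c' (y * r)"
    using beh unfolding behind_def[of k]
  proof (elim disjE conjE)
    assume "edge k i < c - r"
    then have "wall (Suc k) m < c' - y * r"
      using m(2) ahead r c' unfolding edge_def by auto
    then show ?thesis unfolding behind_def edge_def by auto
  next
    assume "hi k i + y / 2 * bar k i \<le> c" "y * bar k i < 2 * g * r"
    then show ?thesis unfolding behind_def using child c' by auto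
  next
    assume "hi k i + y * bar k i \<le> c"
    then show ?thesis unfolding behind_def using child c' yr by linarith
  qed
  then have "sweeping (Suc k) m c' (y * r)"
    using level_up[OF k m(1) yr(1)] sub c' ahead by auto
  then show "reply (2 * k) v c r c'"
  proof (rule reply_up[OF k r])
    show "v < c' - y * r \<or> v \<le> hi (Suc k) m \<and> c + g * r \<le> c'" using v m c' by auto
    show "hi k l \<le> hi (Suc k) m \<or> c' + y * r < lo k l \<or> hi k l < c' - y * r" for l
      using hi_mono[OF k, of l i] lo_mono[OF k, of "i + 1" l] m(1) c' ahead by (cases "l \<le> i") auto
  qed
qed

lemma stuckI:
  assumes k: "K < k" and "gap_len k j \<le> 2 * r" "c - r \<le> lo k (j + 1)" "lo k (j + 1) \<le> c + r"
  shows "stuck k j c r"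
  unfolding stuck_def
proof (intro conjI allI impI)
  fix n assume n: "hi k j \<le> hi (Suc k) n" "hi (Suc k) n < lo k (j + 1)"
  have "gap_len (Suc k) n \<le> gap_len k j"
    using subgap[OF k n] n by (simp add: gap_len_def)
  then show "gap_len (Suc k) n \<le> 2 * r" using assms by simp
qed (use assms in auto)

lemma gap_le:
  assumes "K < k" "c - r \<le> hi k i" "i \<le> n" "lo k (n + 1) \<le> c + r"
  shows "gap_len k n \<le> 2 * r"
  using hi_mono[OF assms(1,3)] assms by (simp add: gap_len_def)

text \<open>After a move to the right past bar \<open>i\<close>, all bars ahead of it are small because the gaps to
  their left are contained in Bob's previous interval.\<close>

lemma sweeping_push:
  assumes k: "K < k" and r: "0 < r" and beh: "behind k i c' (y * r)"
    and c': "c - r \<le> c' - y * r" "c' + y * r \<le> c + r"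
    and G: "\<And>n. i \<le> n \<Longrightarrow> lo k (n + 1) \<le> c + r \<Longrightarrow> gap_len k n \<le> 2 * r"
    and Gi: "gap_len k i \<le> 2 * r"
  shows "sweeping k i c' (y * r)"
proof -
  have prev: "gap_len k (j - 1) \<le> 2 * r" if "j > i" "lo k j \<le> c' + y * r" for j
    using G[of "j - 1"] that c' by auto
  have prev': "y * gap_len k (j - 1) \<le> 2 * (y * r)" if "j > i" "lo k j \<le> c' + y * r" for j
    using mult_left_mono[OF prev[OF that], of y] y_pos by (simp add: mult_ac)
  have "bar k j < 2 * g * (y * r)" if "j > i" "lo k j \<le> c' + y * r" for j
  proof -
    have "bar k j < y * g * gap_len k (j - 1)" by (rule bar_less[OF k])
    also have "\<dots> \<le> y * g * (2 * r)" using prev[OF that] yg_pos by (intro mult_left_mono) auto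
    finally show ?thesis by (simp add: mult_ac)
  qed
  moreover have "\<exists>t\<in>{n - 1, n, n + 1}. y * gap_len k t \<le> 2 * (y * r)"
    if "n \<ge> i" "hi k n \<le> c' + y * r" for n
  proof (cases "n = i")
    case True
    then show ?thesis using mult_left_mono[OF Gi, of y] y_pos by (auto simp: mult_ac)
  next
    case False
    then show ?thesis using prev'[of n] that lo_le_hi[OF k, of n] by auto
  qed
  moreover have "\<exists>t\<in>{j - 1, j}. y * gap_len k t \<le> 2 * (y * r)" if "j > i" "lo k j \<le> c' + y * r" for j
    using prev'[OF that] by auto
  ultimately show ?thesis unfolding sweeping_def using beh by simp
qed

text \<open>If gap \<open>i\<close> is short, another push right keeps bar \<open>i\<close> behind
  and makes everything ahead small. If it is longer than Bob's interval, Alice fits between the wall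
  and bar \<open>i + 1\<close>, which starts the next level.\<close>

lemma step_sweeping_wall:
  assumes k: "K < k" and r: "0 < r" and v: "v \<le> hi k i" and S: "sweeping k i c r"
    and no: "\<not> behind k (i + 1) c r"
    and meet: "lo k (i + 1) \<le> c + r" "c - r \<le> hi k (i + 1)"
    and wall: "c - r \<le> edge k i"
  shows "forces c r (reply (2 * k) v c r)"
proof -
  have beh: "(hi k i + y / 2 * bar k i \<le> c \<and> y * bar k i < 2 * g * r) \<or> hi k i + y * bar k i \<le> c"
    using S wall unfolding sweeping_def behind_def by auto
  have yr: "0 < y * r" "0 < g * r" using y_pos g_pos r by auto
  have cr: "c - r \<le> lo k (i + 1)" using wall unfolding edge_def by auto
  show ?thesis
  proof (cases "gap_len k i \<le> 2 * r")
    case True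
    show ?thesis
    proof (rule push_right[OF r])
      fix c' assume c': "c + g * r \<le> c'" "c - r \<le> c' - y * r" "c' + y * r \<le> c + r"
      have "behind k i c' (y * r)"
        unfolding behind_def using beh c' yr by auto
      moreover have "gap_len k n \<le> 2 * r" if "i \<le> n" "lo k (n + 1) \<le> c + r" for n
        using gap_le[OF k meet(2), of n] True that by (cases "n = i") auto
      ultimately have "sweeping k i c' (y * r)"
        using sweeping_push[OF k r _ c'(2,3)] True by blast
      then show "reply (2 * k) v c r c'"
        using reply_sweeping[OF k r v] c' stuckI[OF k True cr meet(1)] by blast
    qed
  next
    case False
    have fits: "wall k i + 2 * al * r < lo k (i + 1)"
      using fits_or_behind[OF k r _ beh no] False by simp
    have "hi k i \<le> c + r" using meet hi_less_lo[OF k, of i] by linarith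
    then obtain t where t: "t \<in> {i - 1, i, i + 1}" and Gt: "y * gap_len k t \<le> 2 * r"
      using S cr unfolding sweeping_def by force
    note sub = subgap_small[OF k _ _ t Gt]
    show ?thesis
    proof (rule place_between[OF fits])
      show "c - r \<le> wall k i" using wall by (simp add: edge_def)
      fix c' assume c': "wall k i < c' - y * r" "c' + y * r < lo k (i + 1)"
      obtain m where m: "hi k i \<le> hi (Suc k) m" "wall (Suc k) m \<le> wall k i"
        using obtain_child[OF k, of i] by blast
      have "behind (Suc k) m c' (y * r)"
        unfolding behind_def edge_def using m c' by auto
      then have "sweeping (Suc k) m c' (y * r)"
        using level_up[OF k m(1) yr(1)] sub c' by auto
      then show "reply (2 * k) v c r c'"
      proof (rule reply_up[OF k r])
        show "v < c' - y * r \<or> v \<le> hi (Suc k) m \<and> c + g * r \<le> c'"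
          using v c' hi_less_wall[OF k, of i] by auto
        show "hi k l \<le> hi (Suc k) m \<or> c' + y * r < lo k l \<or> hi k l < c' - y * r" for l
          using hi_mono[OF k, of l i] lo_mono[OF k, of "i + 1" l] m(1) c' by (cases "l \<le> i") auto
      qed
    qed (rule meet)
  qed
qed

text \<open>The space left of bar \<open>i + 1\<close> is free of the chain of bar \<open>i\<close>,
  so both sides are available and the position of the centre relative to the short bar
  \<open>i + 1\<close> decides.\<close>

lemma step_sweeping_clear:
  assumes k: "K < k" and r: "0 < r" and v: "v \<le> hi k i" and S: "sweeping k i c r"
    and meet: "lo k (i + 1) \<le> c + r" "c - r \<le> hi k (i + 1)"
    and clear: "edge k i < c - r"
  shows "forces c r (reply (2 * k) v c r)"
proof -
  have yr: "0 < y * r" "0 < g * r" "g * r < r" "y * r < r"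
    using y_pos g_pos r g_less_1 y_less_1 by auto
  have gy: "g * r * (1 + y) \<le> r"
    using mult_right_mono[OF less_imp_le[OF y1g_less], of r] r by (simp add: mult_ac)
  have "c - r \<le> edge k (i + 1)" using meet hi_less_edge[OF k, of "i + 1"] by linarith
  then have bar: "bar k (i + 1) < 2 * g * r" using S meet unfolding sweeping_def by auto
  have v': "v \<le> hi k (i + 1)" using v hi_mono[OF k, of i "i + 1"] by linarith
  have clear': "wall k i < c - r" if "c - r \<le> lo k (i + 1)"
    using clear that unfolding edge_def by auto
  show ?thesis
  proof (cases "lo k (i + 2) \<le> c + r")
    case many: True
    have G1: "gap_len k n \<le> 2 * r" if "i + 1 \<le> n" "lo k (n + 1) \<le> c + r" for n
      using gap_le[OF k meet(2) that] .
    have G2: "gap_len k (i + 1) \<le> 2 * r" using G1[of "i + 1"] many by (simp add: add.assoc)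
    show ?thesis
    \<comment> \<open>Up to this threshold one push left brings the centre to within
      \<open>g * (y * r)\<close> right of \<open>lo k (i + 1)\<close>, the first alternative of
      \<open>retreating\<close> with \<open>R = y * (y * r)\<close>. Beyond it a push right passes
      \<open>hi + y / 2 * bar\<close>, because the bar is shorter than
      \<open>2 * g * r\<close>.\<close>
    proof (cases "c - g * r * (1 + y) \<le> lo k (i + 1)")
      case True
      have cr: "c - r \<le> lo k (i + 1)" using True gy by linarith
      have sub: "gap_len (Suc k) n \<le> 2 * g * (y * (y * r))"
        if "hi k i \<le> hi (Suc k) n" "hi (Suc k) n < lo k (i + 1)" for n
      proof -
        have "gap_len (Suc k) n \<le> y\<^sup>2 * g / 6 * gap_len k (i + 1)"
          using subgap_gap_len[OF k that, of "i + 1"] by auto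
        also have "\<dots> \<le> y\<^sup>2 * g / 6 * (2 * r)" using G2 g_pos by (intro mult_left_mono) auto
        also have "\<dots> \<le> y\<^sup>2 * g * 2 * r" using g_pos r by simp
        finally show ?thesis by (simp add: power2_eq_square mult_ac)
      qed
      show ?thesis
      proof (rule push_left[OF r])
        fix c' assume c': "c' \<le> c - g * r" "c - r \<le> c' - y * r"
        have "y * (y * r) \<le> 1 * (y * r)" "g * (y * (y * r)) \<le> 1 * (y * (y * r))"
          using y_less_1 g_less_1 y_pos r by (intro mult_right_mono; simp)+
        then have gyr: "g * (y * (y * r)) \<le> r" "y * (y * r) \<le> r"
          using yr by linarith+
        have "stuck k i c r"
          unfolding stuck_def using cr meet sub gyr by fastforce
        then show "reply (2 * k) v c r c'"
          using c' clear'[OF cr] True yr gyr y_pos sub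
          by (intro reply_retreating[OF k r _ v, of "y * (y * r)"]) (auto simp: algebra_simps)
      qed
    next
      case False
      show ?thesis
      proof (rule push_right[OF r])
        fix c' assume c': "c + g * r \<le> c'" "c - r \<le> c' - y * r" "c' + y * r \<le> c + r"
        have hi: "hi k (i + 1) = lo k (i + 1) + bar k (i + 1)" by (simp add: bar_def)
        have "y * bar k (i + 1) \<le> y * (2 * g * r)" using bar y_pos by simp
        then have "y / 2 * bar k (i + 1) \<le> g * r * y" by (simp add: mult_ac)
        then have "hi k (i + 1) + y / 2 * bar k (i + 1) \<le> c'"
          using False bar c' hi by (simp add: algebra_simps)
        moreover have "y * bar k (i + 1) < 2 * g * (y * r)" using bar y_pos by simp
        ultimately have "behind k (i + 1) c' (y * r)" unfolding behind_def by blast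
        then have "sweeping k (i + 1) c' (y * r)"
          using sweeping_push[OF k r _ c'(2,3) G1 G2] by blast
        moreover have "stuck k (i + 1) c r"
          using stuckI[OF k G2] many meet hi_less_lo[OF k, of "i + 1"] by (simp add: add.assoc)
        ultimately show "reply (2 * k) v c r c'"
          using reply_sweeping[OF k r v'] c' by blast
      qed
    qed
  next
    case one: False
    have "\<forall>j>i. lo k j \<le> c + r \<longrightarrow> c - r \<le> hi k j \<longrightarrow> (\<exists>t\<in>{j - 1, j}. y * gap_len k t \<le> 2 * r)"
      using S unfolding sweeping_def by blast
    from this[rule_format, of "i + 1"] meet
    obtain t where t: "t \<in> {i, i + 1}" and Gt: "y * gap_len k t \<le> 2 * r" by auto
    show ?thesis
    \<comment> \<open>If one push cannot reach the right end, the bound on the bar puts its left end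
      within reach, so the retreat starts in the second alternative with
      \<open>R = y * r\<close>.\<close>
    proof (cases "hi k (i + 1) \<le> c + g * r")
      case True
      show ?thesis
      proof (rule push_right[OF r])
        fix c' assume c': "c + g * r \<le> c'" "c' + y * r \<le> c + r"
        have "y\<^sup>2 * gap_len k t \<le> 2 * (y * r)"
          using mult_left_mono[OF Gt, of y] y_pos by (simp add: power2_eq_square mult_ac)
        then have "passing k (i + 1) c' (y * r)"
          unfolding passing_def using True c' bar y_pos one t by (auto simp: add.assoc)
        then show "reply (2 * k) v c r c'"
          using reply_passing[OF k r _ v'] c' by blast
      qed
    next
      case False
      have lo: "c - g * r \<le> lo k (i + 1)" using False bar by (simp add: bar_def)
      then have cr: "c - r \<le> lo k (i + 1)" using yr by linarith
      have sub: "gap_len (Suc k) n \<le> 2 * g * (y * r)"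
        if "hi k i \<le> hi (Suc k) n" "hi (Suc k) n < lo k (i + 1)" for n
      proof -
        have "gap_len (Suc k) n \<le> y\<^sup>2 * g / 6 * gap_len k t"
          using subgap_gap_len[OF k that, of t] t by auto
        also have "\<dots> = y * g / 6 * (y * gap_len k t)" by (simp add: power2_eq_square)
        also have "\<dots> \<le> y * g / 6 * (2 * r)" using Gt yg_pos by (intro mult_left_mono) auto
        also have "\<dots> \<le> 2 * g * (y * r)" using yr g_pos y_pos by (simp add: mult_ac)
        finally show ?thesis .
      qed
      show ?thesis
      proof (rule push_left[OF r])
        fix c' assume c': "c' \<le> c - g * r" "c - r \<le> c' - y * r"
        have gyr': "g * (y * r) \<le> 1 * (y * r)"
          using g_less_1 yr by (intro mult_right_mono) auto
        then have gyr: "g * (y * r) \<le> r" "g * (y * r) \<le> y * r" using yr by linarith+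
        have "stuck k i c r"
          unfolding stuck_def using cr meet sub gyr by fastforce
        then show "reply (2 * k) v c r c'"
          using c' clear'[OF cr] lo yr gyr y_pos sub
          by (intro reply_retreating[OF k r _ v, of "y * r"]) (auto simp: algebra_simps)
      qed
    qed
  qed
qed

lemma sweeping_advance:
  assumes "sweeping k i c r" "behind k (i + 1) c r" shows "sweeping k (i + 1) c r"
  using assms unfolding sweeping_def by auto


lemma step_sweeping:
  assumes k: "K < k" and r: "0 < r" and v: "v \<le> hi k i" and S: "sweeping k i c r"
  shows "forces c r (reply (2 * k) v c r)"
proof -
  \<comment> \<open>Advancing over bars already behind must end: \<open>behind\<close> forces
    \<open>hi k j <= c\<close>, while the right ends are unbounded.\<close>
  have "\<exists>j\<ge>i. sweeping k j c r \<and> \<not> behind k (j + 1) c r"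
  proof (rule ccontr)
    assume no: "\<not> ?thesis"
    have all: "sweeping k j c r" if "i \<le> j" for j
      using that
    proof (induction rule: int_ge_induct)
      case (step j)
      then show ?case using no sweeping_advance by blast
    qed (rule S)
    obtain j where "j \<ge> i" "c < hi k j" using ex_hi_gt[OF k] by blast
    then show False using behind_hi[OF k r, of j c] all[of j] unfolding sweeping_def by auto
  qed
  then obtain j where j: "i \<le> j" "sweeping k j c r" "\<not> behind k (j + 1) c r" by blast
  have v': "v \<le> hi k j" using v hi_mono[OF k j(1)] by linarith
  show ?thesis
  proof (cases "c + r < lo k (j + 1)")
    case True
    then show ?thesis using step_sweeping_ahead[OF k r v' j(2)] by simp
  next
    case False
    \<comment> \<open>A bar left of Bob's interval whose edge is not cleared is shorter than
      \<open>2 * g * r\<close>; since \<open>c\<close> is more than \<open>r\<close> beyond it, the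
      second alternative of \<open>behind\<close> would hold.\<close>
    have "c - r \<le> hi k (j + 1)"
    proof (rule ccontr)
      assume a: "\<not> ?thesis"
      have "c - r \<le> edge k (j + 1)" using j(3) unfolding behind_def by auto
      then have b: "bar k (j + 1) < 2 * g * r" using j(2) False unfolding sweeping_def by auto
      have "g * r \<le> r" using g_less_1 r by simp
      then have "bar k (j + 1) \<le> 2 * r" using b unfolding mult.assoc by linarith
      then have "y * bar k (j + 1) \<le> 1 * (2 * r)"
        using y_less_1 y_pos r bar_nonneg[OF k] by (intro mult_mono[of y 1]) auto
      moreover have "y * bar k (j + 1) < 2 * g * r"
        using b mult_right_mono[of y 1 "bar k (j + 1)"] y_less_1 bar_nonneg[OF k, of "j + 1"] by auto
      ultimately show False using a j(3) unfolding behind_def by auto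
    qed
    then show ?thesis
      using step_sweeping_wall[OF k r v' j(2,3)] step_sweeping_clear[OF k r v' j(2)] False
      by (cases "c - r \<le> edge k j") auto
  qed
qed

lemma step:
  assumes "Inv N v c r" shows "forces c r (reply N v c r)"
  using assms step_sweeping step_retreating step_passing unfolding Inv_def by blast

section \<open>Start and limit of the play\<close>

text \<open>Only finitely many bars begin in a bounded region. The gap before each contains a
  next-level gap, the one after a child, and half the least of these lengths bounds \<open>r\<close>
  from below.\<close>

lemma not_stuck:
  assumes k: "K < k"
  shows "\<exists>\<delta>>0. \<forall>j c r. stuck k j c r \<longrightarrow> p \<le> c - r \<longrightarrow> c + r \<le> q \<longrightarrow> \<delta> \<le> r"
proof -
  define J where "J = {j. p \<le> lo k (j + 1) \<and> lo k (j + 1) \<le> q}"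
  have "finite ((\<lambda>j. j + 1) ` J)"
    by (rule finite_subset[OF _ finite_lo[OF k, of p q]]) (auto simp: J_def)
  then have fin: "finite J" by (rule finite_imageD) simp
  have "\<forall>j. \<exists>m. hi k j \<le> hi (Suc k) m \<and> hi (Suc k) m < lo k (j + 1)"
    using child[OF k] by blast
  then obtain m where m: "\<And>j. hi k j \<le> hi (Suc k) (m j)" "\<And>j. hi (Suc k) (m j) < lo k (j + 1)"
    by metis
  define \<delta> where "\<delta> = Min (insert 1 ((\<lambda>j. gap_len (Suc k) (m j) / 2) ` J))"
  have "0 < \<delta>" unfolding \<delta>_def using fin gap_len_pos[of "Suc k"] k by auto
  moreover have "\<delta> \<le> r" if "stuck k j c r" "p \<le> c - r" "c + r \<le> q" for j c r
  proof -
    have "j \<in> J" using that unfolding stuck_def J_def by auto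
    then have "\<delta> \<le> gap_len (Suc k) (m j) / 2" unfolding \<delta>_def using fin by (intro Min_le) auto
    also have "\<dots> \<le> r" using that(1) m[of j] unfolding stuck_def by auto
    finally show ?thesis .
  qed
  ultimately show ?thesis by blast
qed


text \<open>A grid of mesh \<open>\<epsilon> / 2\<close> leaves finitely many cells to treat, and
  every window of length \<open>\<epsilon>\<close> contains a whole cell.\<close>

lemma uniformly_dense:
  fixes \<epsilon> M :: real
  assumes dense: "\<And>p q. p < q \<Longrightarrow> \<exists>K'. \<forall>k>K'. \<exists>j. p \<le> hi k j \<and> lo k (j + 1) \<le> q"
    and \<epsilon>: "0 < \<epsilon>"
  shows "\<exists>K'. \<forall>k>K'. \<forall>p. \<bar>p\<bar> \<le> M \<longrightarrow> (\<exists>j. p \<le> hi k j \<and> lo k (j + 1) \<le> p + \<epsilon>)"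
proof -
  define h where "h = \<epsilon> / 2"
  have h: "0 < h" using \<epsilon> by (simp add: h_def)
  obtain F where F: "\<And>t k. F t < k \<Longrightarrow> \<exists>j. h * of_int t \<le> hi k j \<and> lo k (j + 1) \<le> h * of_int (t + 1)"
    using dense[of "h * of_int t" "h * of_int (t + 1)" for t :: int] h by simp metis
  define T where "T = {\<lceil>- M / h\<rceil>..\<lceil>M / h\<rceil>}"
  define K' where "K' = Max (insert 0 (F ` T))"
  have "\<exists>j. p \<le> hi k j \<and> lo k (j + 1) \<le> p + \<epsilon>" if k: "K' < k" and p: "\<bar>p\<bar> \<le> M" for k p
  proof -
    define t where "t = \<lceil>p / h\<rceil>"
    have "- M / h \<le> p / h" "p / h \<le> M / h"
      using p h by (intro divide_right_mono; linarith)+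
    then have "t \<in> T" unfolding t_def T_def by (auto intro!: ceiling_mono)
    then have "F t \<le> K'" unfolding K'_def by (intro Max_ge) (auto simp: T_def)
    then obtain j where j: "h * of_int t \<le> hi k j" "lo k (j + 1) \<le> h * of_int (t + 1)"
      using F[of t k] k by auto
    have "p / h \<le> of_int t" "of_int t < p / h + 1" unfolding t_def by linarith+
    then have "p \<le> h * of_int t" "h * of_int t < p + h"
      using h by (simp_all add: field_simps)
    then show ?thesis using j by (intro exI[of _ j]) (simp add: algebra_simps h_def)
  qed
  then show ?thesis by blast
qed

text \<open>At a deep level the bars and gaps near Bob's opening interval are shorter than
  \<open>2 * g * r\<close>, so a sweep can start from a bar far to the left.\<close>

lemma initial_Inv:
  assumes dense: "\<And>p q. p < q \<Longrightarrow> \<exists>K'. \<forall>k>K'. \<exists>j. p \<le> hi k j \<and> lo k (j + 1) \<le> q"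
    and r: "0 < r"
  shows "\<exists>k v. Inv (2 * k) v c r"
proof -
  define \<epsilon> where "\<epsilon> = g * r"
  have \<epsilon>: "0 < \<epsilon>" "\<epsilon> < r" using r g_pos g_less_1 by (simp_all add: \<epsilon>_def)
  obtain K' where K': "\<And>k p. K' < k \<Longrightarrow> \<bar>p\<bar> \<le> \<bar>c\<bar> + 5 * r \<Longrightarrow> \<exists>j. p \<le> hi k j \<and> lo k (j + 1) \<le> p + \<epsilon>"
    using uniformly_dense[OF dense \<epsilon>(1), of "\<bar>c\<bar> + 5 * r"] by blast
  define k where "k = Suc (max K K')"
  have k: "K < k" "K' < k" by (auto simp: k_def)
  have G_small: "gap_len k n < 2 * \<epsilon>" if n: "hi k n \<le> c + r" "c - r \<le> lo k (n + 1)" for n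
  proof -
    \<comment> \<open>The maximum keeps \<open>p\<close> in the range covered by \<open>K'\<close>.
      Were it \<open>c - 3 * r\<close>, the gap would end left of Bob's interval.\<close>
    define p where "p = max (hi k n + \<epsilon> / 2) (c - 3 * r)"
    have "\<bar>p\<bar> \<le> \<bar>c\<bar> + 5 * r" using n \<epsilon> r unfolding p_def by (auto simp: max_def)
    then obtain j where j: "p \<le> hi k j" "lo k (j + 1) \<le> p + \<epsilon>" using K' k by blast
    have "n < j" using j(1) hi_mono[OF k(1), of j n] \<epsilon> unfolding p_def by (cases "n < j") auto
    then have "lo k (n + 1) \<le> p + \<epsilon>" using lo_mono[OF k(1), of "n + 1" "j + 1"] j(2) by auto
    then show ?thesis using n \<epsilon> unfolding p_def gap_len_def by (auto simp: max_def split: if_splits)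
  qed
  have bar_small: "bar k j < 2 * g * r" if j: "lo k j \<le> c + r" "c - r \<le> edge k j" for j
  proof -
    define p where "p = max (lo k j) (c - 5 * r)"
    have "\<bar>p\<bar> \<le> \<bar>c\<bar> + 5 * r" using j \<epsilon> r unfolding p_def by (auto simp: max_def)
    then obtain j' where j': "p \<le> hi k j'" "lo k (j' + 1) \<le> p + \<epsilon>" using K' k by blast
    have "j \<le> j'"
      using j'(1) hi_less_lo'[OF k(1), of j' j] unfolding p_def by (cases "j \<le> j'") auto
    then have "hi k j < p + \<epsilon>" using hi_less_lo'[OF k(1), of j "j' + 1"] j'(2) by auto
    moreover have "c - 3 * r \<le> hi k j"
      using G_small[of j] j(2) \<epsilon> r unfolding gap_len_def edge_def by (cases "hi k j \<le> c + r") auto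
    ultimately show ?thesis
      using \<epsilon> unfolding p_def bar_def \<epsilon>_def by (auto simp: max_def split: if_splits)
  qed
  have yG: "y * gap_len k n \<le> 2 * r" if "hi k n \<le> c + r" "c - r \<le> lo k (n + 1)" for n
  proof -
    have "y * gap_len k n \<le> 1 * (2 * \<epsilon>)"
      using G_small[OF that] gap_len_pos[OF k(1), of n] y_less_1 y_pos by (intro mult_mono) auto
    then show ?thesis using \<epsilon> by simp
  qed
  have yG': "y * gap_len k (j - 1) \<le> 2 * r \<or> y * gap_len k j \<le> 2 * r"
    if j: "lo k j \<le> c + r" "c - r \<le> hi k j" for j
  proof (cases "hi k j \<le> c + r")
    case True
    then show ?thesis using yG[of j] hi_less_lo[OF k(1), of j] j by auto
  next
    case False
    have "c - r \<le> lo k j"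
      using bar_small[OF j(1)] j(2) hi_less_edge[OF k(1), of j] False \<epsilon> r
      unfolding bar_def \<epsilon>_def mult.assoc by linarith
    then show ?thesis using yG[of "j - 1"] hi_less_lo'[OF k(1), of "j - 1" j] j by auto
  qed
  obtain i where "lo k (i + 1) < c - r"
    using ex_lo_less[OF k(1), of "c - r"] by (metis diff_add_cancel)
  then have "behind k i c r" unfolding behind_def edge_def by auto
  then have "sweeping k i c r" unfolding sweeping_def using bar_small yG yG' by blast
  then show ?thesis unfolding Inv_def using k(1) r by blast
qed

text \<open>Level \<open>k\<close> is settled in the round where the stage first exceeds
  \<open>2 * k\<close>; there a bar either misses Bob's interval or ends at or before
  \<open>v n\<close>, and \<open>v n < x\<close>.\<close>

lemma limit_point:
  fixes N :: "nat \<Rightarrow> nat" and v c :: "nat \<Rightarrow> real"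
  assumes r: "0 < r"
    and inv: "\<And>n. Inv (N n) (v n) (c n) (y ^ n * r)"
    and tr: "\<And>n. Tr (N n) (v n) (c n) (y ^ n * r) (N (Suc n)) (v (Suc n)) (c (Suc n))"
    and x: "\<And>n. \<bar>x - c n\<bar> \<le> y ^ n * r"
    and k: "N 0 \<le> 2 * k"
  shows "x < lo k l \<or> hi k l < x"
proof -
  have pos: "0 < y ^ n * r" for n using r y_pos by simp
  have lim: "(\<lambda>n. y ^ n * r) \<longlonglongrightarrow> 0"
    using tendsto_mult_left_zero[OF LIMSEQ_realpow_zero[of y]] y_pos y_less_1 by auto
  have vc: "v n \<le> c n" for n
    using inv[of n] unfolding Inv_def
  proof (elim conjE disjE exE)
    fix k i assume "K < k" "v n \<le> hi k i" "sweeping k i (c n) (y ^ n * r)"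
    then show ?thesis using behind_hi[of k "y ^ n * r" i "c n"] pos[of n] unfolding sweeping_def by linarith
  next
    fix k i R assume "K < k" "v n \<le> hi k i" "retreating k i R (c n) (y ^ n * r)"
    then show ?thesis using hi_less_wall[of k i] pos[of n] unfolding retreating_def by linarith
  next
    fix k i assume "v n \<le> hi k i" "passing k i (c n) (y ^ n * r)"
    then show ?thesis unfolding passing_def by linarith
  qed
  \<comment> \<open>As long as \<open>x <= v n\<close>, no later interval lies right of
    \<open>v n\<close>, so all centres move right. The first move gains
    \<open>g * (y ^ n * r)\<close> over \<open>c n\<close>, which is at least \<open>v n\<close>,
    and this gain survives in the limit \<open>x\<close>.\<close>
  have above: "v n < x" for n
  proof (rule ccontr)
    assume "\<not> v n < x"
    have *: "v n \<le> v m \<and> c m + g * (y ^ m * r) \<le> c (Suc m)" if "n \<le> m" for m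
      using that
    proof (induction rule: dec_induct)
      case base
      then show ?case using tr[of n] x[of "Suc n"] \<open>\<not> v n < x\<close> unfolding Tr_def by auto
    next
      case (step m)
      then have "v n \<le> v (Suc m)" using tr[of m] x[of "Suc m"] \<open>\<not> v n < x\<close> unfolding Tr_def by auto
      then show ?case using tr[of "Suc m"] x[of "Suc (Suc m)"] \<open>\<not> v n < x\<close> unfolding Tr_def by auto
    qed
    have "c n + g * (y ^ n * r) \<le> c m" if "Suc n \<le> m" for m
      using that
    proof (induction rule: dec_induct)
      case base
      then show ?case using * by auto
    next
      case (step m)
      have "0 < g * (y ^ m * r)" using g_pos pos by simp
      then show ?case using *[of m] step by auto
    qed
    then have "v n + g * (y ^ n * r) - x \<le> y ^ m * r" if "Suc n \<le> m" for m
      using that x[of m] vc[of n] by fastforce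
    then have "v n + g * (y ^ n * r) - x \<le> 0"
      by (intro LIMSEQ_le_const[OF lim]) blast
    moreover have "0 < g * (y ^ n * r)" using g_pos pos by simp
    ultimately show False using \<open>\<not> v n < x\<close> by linarith
  qed
  have "N n \<le> N (Suc n)" for n using tr[of n] unfolding Tr_def by simp
  then have mono: "N n \<le> N m" if "n \<le> m" for n m
    using lift_Suc_mono_le[of N] that by blast
  \<comment> \<open>Otherwise the stage is eventually constant, and intervals shrinking to a point
    would be \<open>stuck\<close> forever at one level.\<close>
  have "\<exists>n. 2 * k < N n"
  proof (rule ccontr)
    assume "\<not> ?thesis"
    then have "range N \<subseteq> {..2 * k}" by (auto simp: not_less)
    then have fin: "finite (range N)" using finite_subset by blast
    obtain n0 where n0: "N n0 = Max (range N)" using Max_in[OF fin] by auto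
    have const: "N n = N n0" if "n0 \<le> n" for n
      using mono[OF that] Max_ge[OF fin, of "N n"] n0 by auto
    have step: "\<exists>k' j. N n0 = 2 * k' \<and> stuck k' j (c n) (y ^ n * r)" if "n0 \<le> n" for n
      using tr[of n] const[of n] const[of "Suc n"] that unfolding Tr_def by simp
    obtain k' where k': "N n0 = 2 * k'" using step[of n0] by auto
    have "odd (2 * i + 1)" for i :: nat by simp
    then have "K < k'" using inv[of n0] k' unfolding Inv_def by auto
    obtain \<delta> where \<delta>: "0 < \<delta>" "\<And>j c r'. stuck k' j c r' \<Longrightarrow> x - 2 * r \<le> c - r' \<Longrightarrow> c + r' \<le> x + 2 * r \<Longrightarrow> \<delta> \<le> r'"
      using not_stuck[OF \<open>K < k'\<close>, of "x - 2 * r" "x + 2 * r"] by blast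
    have "eventually (\<lambda>n. y ^ n * r < \<delta>) sequentially"
      using order_tendstoD(2)[OF lim \<delta>(1)] .
    then obtain n where n: "n0 \<le> n" "y ^ n * r < \<delta>"
      unfolding eventually_sequentially by (meson linear order_trans)
    obtain j where "stuck k' j (c n) (y ^ n * r)"
      using step[OF n(1)] k' by auto
    moreover have "y ^ n * r \<le> r" using power_le_one[of y n] y_pos y_less_1 r by simp
    ultimately have "\<delta> \<le> y ^ n * r" using x[of n] by (intro \<delta>(2)) (auto simp: abs_le_iff)
    then show False using n(2) by simp
  qed
  then obtain n where n: "2 * k < N n" "\<And>m. m < n \<Longrightarrow> N m \<le> 2 * k"
    using exists_least_iff[of "\<lambda>n. 2 * k < N n"] by (auto simp: not_less)
  then obtain m where m: "n = Suc m" using k by (cases n) auto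
  have "hi k l \<le> v n \<or> c n + y ^ n * r < lo k l \<or> hi k l < c n - y ^ n * r"
    using tr[of m] n(1) n(2)[of m] m unfolding Tr_def by (simp add: mult.assoc)
  then show ?thesis using above[of n] x[of n] by auto
qed

end

section \<open>Endpoints of an admissible system\<close>

text \<open>Bars and gaps may contain any of their endpoints; the ambiguity is a finite set, which
  keeps \<open>X\<close> Borel.\<close>

lemma len_between:
  assumes "{p<..<q} \<subseteq> X" "X \<subseteq> {p..q}" "p \<le> q"
  shows "len X = q - p"
proof -
  have "X = {p<..<q} \<union> (X \<inter> {p, q})"
    using assms(1,2) by force
  moreover have "{p<..<q} \<union> (X \<inter> {p, q}) \<in> sets borel"
  proof (rule sets.Un)
    show "X \<inter> {p, q} \<in> sets borel" by (intro borel_closed finite_imp_closed) auto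
  qed simp
  ultimately have X: "X \<in> sets lborel" by simp
  have "ennreal (q - p) \<le> emeasure lborel X"
    using emeasure_mono[OF assms(1), of lborel] X assms(3) by simp
  moreover have "emeasure lborel X \<le> ennreal (q - p)"
    using emeasure_mono[OF assms(2), of lborel] assms(3) by simp
  ultimately show ?thesis
    using assms(3) by (metis antisym enn2real_ennreal diff_ge_0_iff_ge measure_def)
qed

locale admissible_intervals =
  fixes C :: interval_system
  assumes adm: "admissible_system C"
begin

lemmas adm_interval = adm[unfolded admissible_system_def, THEN conjunct1]
lemmas adm_separated = adm[unfolded admissible_system_def, THEN conjunct2, THEN conjunct1]
lemmas adm_ordered = adm[unfolded admissible_system_def, THEN conjunct2, THEN conjunct2, THEN conjunct1]
lemmas adm_finite = adm[unfolded admissible_system_def, THEN conjunct2, THEN conjunct2, THEN conjunct2, THEN conjunct1]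
lemmas adm_dense = adm[unfolded admissible_system_def, THEN conjunct2, THEN conjunct2, THEN conjunct2, THEN conjunct2, THEN conjunct1]
lemmas adm_C = adm[unfolded admissible_system_def, THEN conjunct2, THEN conjunct2, THEN conjunct2, THEN conjunct2, THEN conjunct2, THEN conjunct1]
lemmas adm_gap = adm[unfolded admissible_system_def, THEN conjunct2, THEN conjunct2, THEN conjunct2, THEN conjunct2, THEN conjunct2, THEN conjunct2]

definition lo :: "nat \<Rightarrow> int \<Rightarrow> real" where "lo k i = Inf (C k i)"
definition hi :: "nat \<Rightarrow> int \<Rightarrow> real" where "hi k i = Sup (C k i)"

lemma
  assumes "0 < k"
  shows is_interval_C: "is_interval (C k i)"
    and bdd_above_C: "bdd_above (C k i)" and bdd_below_C: "bdd_below (C k i)"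
    and C_nonempty: "C k i \<noteq> {}"
proof -
  have "k \<ge> 1" using assms by simp
  then have "is_interval (C k i) \<and> bounded (C k i) \<and> C k i \<noteq> {}"
    using adm_interval by blast
  then show "is_interval (C k i)" "bdd_above (C k i)" "bdd_below (C k i)" "C k i \<noteq> {}"
    using bounded_imp_bdd_above bounded_imp_bdd_below by auto
qed

lemma C_bounds:
  assumes "0 < k" "x \<in> C k i" shows "lo k i \<le> x" "x \<le> hi k i"
  using assms bdd_above_C bdd_below_C unfolding lo_def hi_def by (auto intro: cInf_lower cSup_upper)

lemma C_inner: 
  assumes k: "0 < k" and "lo k i < x" "x < hi k i" shows "x \<in> C k i"
proof -
  obtain p where p: "p \<in> C k i" "p < x"
    using assms(2) C_nonempty[OF k] cInf_lessD unfolding lo_def by blast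
  obtain q where q: "q \<in> C k i" "x < q"
    using assms(3) C_nonempty[OF k] less_cSupD unfolding hi_def by blast
  show ?thesis
    using is_interval_C[OF k, of i] p q unfolding is_interval_1 by (meson less_imp_le)
qed

lemma disjoint_C:
  assumes "0 < k" "i \<noteq> j" shows "C k i \<inter> C k j = {}"
  using assms adm_separated by (metis One_nat_def Suc_leI)

sublocale ordered_bars lo hi 0
proof
  fix k :: nat and i :: int and p q :: real
  assume k: "0 < k"
  then have k1: "k \<ge> 1" by simp
  obtain z where "z \<in> C k i" using C_nonempty[OF k] by blast
  then show "lo k i \<le> hi k i" using C_bounds[OF k] by (meson order_trans)
  \<comment> \<open>The order of points alone yields only \<open>hi <= lo\<close>; the positive
    distance makes it strict.\<close>
  define e where "e = setdist (C k i) (C k (i + 1))"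
  have e: "0 < e" using adm_separated k1 unfolding e_def by simp
  have ord: "\<forall>n. \<forall>x\<in>C k (n - 1). \<forall>y\<in>C k n. x < y" using adm_ordered k1 by blast
  have far: "x \<le> z - e" if "x \<in> C k i" "z \<in> C k (i + 1)" for x z
    using setdist_le_dist[OF that] ord[rule_format, of x "i + 1" z] that
    by (auto simp: dist_real_def e_def)
  have "hi k i \<le> z - e" if "z \<in> C k (i + 1)" for z
    unfolding hi_def using C_nonempty[OF k] far[OF _ that] by (intro cSup_least) auto
  then have "hi k i + e \<le> lo k (i + 1)"
    unfolding lo_def using C_nonempty[OF k] by (intro cInf_greatest) (auto simp: algebra_simps)
  then show "hi k i < lo k (i + 1)" using e by simp
  \<comment> \<open>The infimum need not belong to the bar; enlarging the window by 1 captures an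
    actual point of it.\<close>
  have "finite {n. C k n \<inter> {p..q + 1} \<noteq> {}}"
    using adm_finite k1 is_interval_cc bounded_closed_interval by blast
  moreover have "{i. p \<le> lo k i \<and> lo k i \<le> q} \<subseteq> {n. C k n \<inter> {p..q + 1} \<noteq> {}}"
  proof safe
    fix i assume i: "p \<le> lo k i" "lo k i \<le> q" "C k i \<inter> {p..q + 1} = {}"
    obtain z where "z \<in> C k i" "z < lo k i + 1"
      using C_nonempty[OF k] cInf_lessD[of "C k i" "lo k i + 1"] unfolding lo_def by auto
    then show False using i C_bounds[OF k, of z i] by auto
  qed
  ultimately show "finite {i. p \<le> lo k i \<and> lo k i \<le> q}" by (rule rev_finite_subset)
qed

lemma dense_gaps:
  assumes "p < q"
  shows "\<exists>K'. \<forall>k>K'. \<exists>j. p \<le> hi k j \<and> lo k (j + 1) \<le> q"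
proof -
  have "is_interval {p..q} \<and> interior {p..q} \<noteq> {}"
    using assms by (simp add: is_interval_cc interior_atLeastAtMost_real)
  then obtain K' where K': "\<And>k. K' < k \<Longrightarrow> \<exists>m n. m \<noteq> n \<and> C k m \<inter> {p..q} \<noteq> {} \<and> C k n \<inter> {p..q} \<noteq> {}"
    using adm_dense[rule_format, of "{p..q}"] by auto
  have "\<exists>j. p \<le> hi k j \<and> lo k (j + 1) \<le> q" if k: "K' < k" for k
  proof -
    have k0: "0 < k" using k by simp
    obtain m n where "m < n" "C k m \<inter> {p..q} \<noteq> {}" "C k n \<inter> {p..q} \<noteq> {}"
      using K'[OF k] by (metis linorder_neqE)
    then obtain x z where "x \<in> C k m" "p \<le> x" "z \<in> C k n" "z \<le> q" by auto
    then show ?thesis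
      using C_bounds[OF k0] lo_mono[OF k0, of "m + 1" n] \<open>m < n\<close> 
      by (intro exI[of _ m]) (smt (verit))
  qed
  then show ?thesis by blast
qed

lemma gap_bounds:
  assumes k: "0 < k" and "x \<in> gap C k n" shows "hi k (n - 1) \<le> x" "x \<le> lo k n"
proof -
  show "hi k (n - 1) \<le> x"
    unfolding hi_def using assms C_nonempty[OF k] by (intro cSup_least) (auto simp: gap_def less_imp_le)
  show "x \<le> lo k n"
    unfolding lo_def using assms C_nonempty[OF k] by (intro cInf_greatest) (auto simp: gap_def less_imp_le)
qed

lemma gap_inner:
  assumes k: "0 < k" and "hi k (n - 1) < x" "x < lo k n" shows "x \<in> gap C k n"
  unfolding gap_def using assms C_bounds[OF k] by fastforce

lemma len_C: "0 < k \<Longrightarrow> len (C k n) = hi k n - lo k n"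
  using C_bounds C_inner lo_le_hi by (intro len_between) auto

lemma len_gap:
  assumes "0 < k" shows "len (gap C k n) = lo k n - hi k (n - 1)"
  using gap_bounds[OF assms] gap_inner[OF assms] hi_less_lo[OF assms, of "n - 1"]
  by (intro len_between) auto

lemma gap_C_disjoint:
  assumes k: "0 < k" and x: "x \<in> gap C k j" "x \<in> C k i" shows False
proof -
  consider "i = j - 1" | "i = j" | "i < j - 1" | "j < i" by linarith
  then show False
  proof cases
    case 3
    then show False using gap_bounds[OF k x(1)] C_bounds[OF k x(2)]
      hi_less_lo'[OF k, of i "j - 1"] lo_le_hi[OF k, of "j - 1"] by linarith
  next
    case 4
    then show False using gap_bounds[OF k x(1)] C_bounds[OF k x(2)]
      hi_less_lo'[OF k, of j i] lo_le_hi[OF k, of j] by linarith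
  qed (use x in \<open>auto simp: gap_def\<close>)
qed

section \<open>Nesting of consecutive levels\<close>

definition part :: "nat \<Rightarrow> real set \<Rightarrow> bool" where
  "part k X \<longleftrightarrow> (\<exists>j. X \<subseteq> C k j \<or> X \<subseteq> gap C k j)"

lemma part_C: "0 < k \<Longrightarrow> part k (C (Suc k) n)"
  using adm_C unfolding part_def by simp

lemma part_gap: "0 < k \<Longrightarrow> part k (gap C (Suc k) n)"
  using adm_gap unfolding part_def by simp

text \<open>A bar or gap of level \<open>k\<close> has endpoints of that level only at its own two
  ends.\<close>

lemma no_straddle:
  assumes k: "0 < k" and X: "part k X" and u: "u \<in> X" "v \<in> X" and z: "u < z" "z < v"
    and end_pt: "z = lo k i \<or> z = hi k i"
  shows False
proof -
  have lohi: "lo k i \<le> z" "z \<le> hi k i" using end_pt lo_le_hi[OF k, of i] by auto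
  obtain j where "X \<subseteq> C k j \<or> X \<subseteq> gap C k j" using X unfolding part_def by blast
  then show False
  proof
    assume "X \<subseteq> C k j"
    then have b: "lo k j \<le> u" "v \<le> hi k j" using C_bounds[OF k] u by blast+
    consider "i = j" | "i < j" | "j < i" by linarith
    then show False
    proof cases
      case 1 then show False using b z end_pt by auto
    next
      case 2 then show False using b z lohi hi_less_lo'[OF k, of i j] by linarith
    next
      case 3 then show False using b z lohi hi_less_lo'[OF k, of j i] by linarith
    qed
  next
    assume "X \<subseteq> gap C k j"
    then have b: "hi k (j - 1) \<le> u" "v \<le> lo k j" using gap_bounds[OF k] u by blast+
    show False
    proof (cases "i \<le> j - 1")
      case True then show False using b z lohi hi_mono[OF k, of i "j - 1"] by linarith
    next
      case False then show False using b z lohi lo_mono[OF k, of j i] by linarith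
    qed
  qed
qed

lemma no_straddle_gap:
  assumes k: "0 < k" and z: "hi (Suc k) n < z" and end_pt: "z = lo k i \<or> z = hi k i"
  shows "lo (Suc k) (n + 1) \<le> z"
proof (rule ccontr)
  assume a: "\<not> ?thesis"
  then obtain v where v: "z < v" "v < lo (Suc k) (n + 1)" using dense not_less by metis
  obtain u where u: "hi (Suc k) n < u" "u < z" using dense z by blast
  have "u \<in> gap C (Suc k) (n + 1)" "v \<in> gap C (Suc k) (n + 1)"
    using u v a by (auto intro!: gap_inner)
  then show False using no_straddle[OF k part_gap[OF k] _ _ u(2) v(1) end_pt] by blast
qed

text \<open>Points immediately left of \<open>hi k i\<close> belong to bar \<open>i\<close>, unless
  this bar is a single point; one-point bars therefore need separate treatment in
  \<open>child_exists\<close>.\<close>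

lemma part_left_of_hi:
  assumes k: "0 < k" and p: "s < hi k i" and X: "{s<..<hi k i} \<subseteq> X"
  shows "X \<subseteq> C k j \<Longrightarrow> j = i \<and> lo k i \<le> s"
    and "X \<subseteq> gap C k j \<Longrightarrow> j = i \<and> lo k i = hi k i"
proof -
  assume sub: "X \<subseteq> C k j"
  have in_C: "u \<in> C k j" if "s < u" "u < hi k i" for u
    using sub X that by auto
  note b = C_bounds[OF k in_C]
  have "lo k j \<le> s" using b(1) dense_ge_bounded[OF p] by blast
  moreover have "hi k i \<le> hi k j" using b(2) dense_le_bounded[OF p] by blast
  ultimately show "j = i \<and> lo k i \<le> s"
    using p hi_less_lo'[OF k, of i j] hi_less_lo'[OF k, of j i] lo_le_hi[OF k, of i]
    by (cases i j rule: linorder_cases) auto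
next
  assume sub: "X \<subseteq> gap C k j"
  have in_gap: "u \<in> gap C k j" if "s < u" "u < hi k i" for u
    using sub X that by auto
  note b = gap_bounds[OF k in_gap]
  have 1: "hi k (j - 1) \<le> s" using b(1) dense_ge_bounded[OF p] by blast
  have 2: "hi k i \<le> lo k j" using b(2) dense_le_bounded[OF p] by blast
  have "\<not> j < i" using 2 lo_le_hi[OF k, of j] lo_le_hi[OF k, of i] hi_less_lo'[OF k, of j i] by linarith
  moreover have "\<not> i < j" using 1 p hi_mono[OF k, of i "j - 1"] by auto
  ultimately show "j = i \<and> lo k i = hi k i" using 2 lo_le_hi[OF k, of i] by auto
qed

lemma singleton_bar:
  assumes k: "0 < k" and "lo k i = hi k i" shows "C k i = {hi k i}"
  using C_bounds[OF k, of _ i] C_nonempty[OF k, of i] assms(2) by force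

text \<open>The bar \<open>m\<close> is the first of level \<open>k + 1\<close> to reach
  \<open>hi k i\<close>. Nesting leaves two positions; in the second the gap before bar
  \<open>m\<close> is hidden inside bar \<open>i\<close>.\<close>

lemma child_exists:
  assumes k: "0 < k"
  shows "\<exists>m. hi (Suc k) (m - 1) < hi k i \<and> hi k i \<le> hi (Suc k) m \<and>
    (lo k i \<le> lo (Suc k) m \<and> hi (Suc k) m = hi k i \<or>
     lo (Suc k) m = hi k i \<and> lo k i \<le> hi (Suc k) (m - 1) \<and> hi (Suc k) m \<le> lo k (i + 1))"
proof -
  define p where "p = hi k i"
  have k': "0 < Suc k" by simp
  obtain m0 where "lo (Suc k) m0 < p" using ex_lo_less[OF k'] by blast
  then have m0: "hi (Suc k) (m0 - 1) < p" using hi_less_lo'[OF k', of "m0 - 1" m0] by simp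
  have "\<exists>m. hi (Suc k) (m - 1) < p \<and> p \<le> hi (Suc k) m"
  proof (rule ccontr)
    assume no: "\<not> ?thesis"
    have "hi (Suc k) j < p" if "m0 - 1 \<le> j" for j
      using that
    proof (induction rule: int_ge_induct)
      case (step j)
      then show ?case using no by (metis add_diff_cancel_right' not_less)
    qed (rule m0)
    then show False using ex_hi_gt[OF k', of "m0 - 1" p] by force
  qed
  then obtain m where m: "hi (Suc k) (m - 1) < p" "p \<le> hi (Suc k) m" by blast
  have lo_le: "lo (Suc k) m \<le> p"
    using no_straddle_gap[OF k m(1), of i] by (simp add: p_def)
  have "lo k i \<le> lo (Suc k) m \<and> hi (Suc k) m = p \<or>
     lo (Suc k) m = p \<and> lo k i \<le> hi (Suc k) (m - 1) \<and> hi (Suc k) m \<le> lo k (i + 1)"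
  proof (cases "lo (Suc k) m < p")
    case True
    have hi_eq: "hi (Suc k) m = p"
    proof (rule ccontr)
      assume "hi (Suc k) m \<noteq> p"
      then have "p < hi (Suc k) m" using m by simp
      then obtain v where v: "p < v" "v < hi (Suc k) m" using dense by blast
      obtain u where u: "lo (Suc k) m < u" "u < p" using True dense by blast
      have "u \<in> C (Suc k) m" "v \<in> C (Suc k) m" using u v by (auto intro!: C_inner)
      then show False
        using no_straddle[OF k part_C[OF k, of m] _ _ u(2) v(1), of i] by (auto simp: p_def)
    qed
    have sub: "{lo (Suc k) m<..<hi k i} \<subseteq> C (Suc k) m"
      using C_inner[OF k', of m] hi_eq by (auto simp: p_def)
    obtain j where "C (Suc k) m \<subseteq> C k j \<or> C (Suc k) m \<subseteq> gap C k j"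
      using part_C[OF k, of m] unfolding part_def by blast
    then show ?thesis
    proof
      assume "C (Suc k) m \<subseteq> C k j"
      then show ?thesis using part_left_of_hi(1)[OF k _ sub] True hi_eq by (auto simp: p_def)
    next
      \<comment> \<open>Then bar \<open>i\<close> is the point \<open>p\<close>, missed by bar
        \<open>m\<close>. So \<open>p\<close> falls into the gap after bar \<open>m\<close>, which
        has further points and fits neither a bar nor a gap of level \<open>k\<close>.\<close>
      assume g: "C (Suc k) m \<subseteq> gap C k j"
      then have j: "j = i" "lo k i = p" using part_left_of_hi(2)[OF k _ sub] True by (auto simp: p_def)
      have pC: "C k i = {p}" using singleton_bar[OF k] j by (auto simp: p_def)
      have "p \<in> gap C (Suc k) (m + 1)"
        unfolding gap_def
      proof safe
        fix z assume "z \<in> C (Suc k) (m + 1 - 1)"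
        then show "z < p" using g pC j(1) unfolding gap_def by auto
      next
        fix z assume "z \<in> C (Suc k) (m + 1)"
        then show "p < z" using C_bounds[OF k', of z "m + 1"] hi_less_lo[OF k', of m] hi_eq by simp
      qed
      moreover obtain u where u: "hi (Suc k) m < u" "u < lo (Suc k) (m + 1)"
        using dense[OF hi_less_lo[OF k', of m]] by blast
      moreover have "u \<in> gap C (Suc k) (m + 1)" using u by (auto intro: gap_inner)
      moreover obtain j' where "gap C (Suc k) (m + 1) \<subseteq> C k j' \<or> gap C (Suc k) (m + 1) \<subseteq> gap C k j'"
        using part_gap[OF k] unfolding part_def by blast
      ultimately have False
        using gap_C_disjoint[OF k, of p _ i] disjoint_C[OF k, of j' i] pC hi_eq by (cases "j' = i") auto
      then show ?thesis ..
    qed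
  next
    case False
    then have lo_eq: "lo (Suc k) m = p" using lo_le by simp
    obtain j where "C (Suc k) m \<subseteq> C k j \<or> C (Suc k) m \<subseteq> gap C k j"
      using part_C[OF k, of m] unfolding part_def by blast
    then show ?thesis
    proof
      assume sub: "C (Suc k) m \<subseteq> C k j"
      have b: "lo k j \<le> lo (Suc k) m" "hi (Suc k) m \<le> hi k j"
        unfolding lo_def hi_def using sub C_nonempty[OF k', of m] bdd_above_C[OF k] bdd_below_C[OF k]
        by (auto intro: cInf_superset_mono cSup_subset_mono)
      have "j = i"
        using b lo_eq m hi_less_lo'[OF k, of i j] hi_less_lo'[OF k, of j i] lo_le_hi[OF k, of i]
        by (cases i j rule: linorder_cases) (auto simp: p_def)
      then show ?thesis using b m lo_eq by (auto simp: p_def)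
    next
      assume sub: "C (Suc k) m \<subseteq> gap C k j"
      have b1: "hi k (j - 1) \<le> p"
        unfolding lo_eq[symmetric] lo_def using sub gap_bounds[OF k] C_nonempty[OF k', of m]
        by (intro cInf_greatest) blast+
      have b2: "hi (Suc k) m \<le> lo k j"
        unfolding hi_def using sub gap_bounds[OF k] C_nonempty[OF k', of m]
        by (intro cSup_least) blast+
      have "\<not> j < i"
        using b2 m lo_le_hi[OF k, of j] lo_le_hi[OF k, of i] hi_less_lo'[OF k, of j i] by (auto simp: p_def)
      moreover have "\<not> i + 1 < j"
        using b1 hi_less_lo'[OF k, of i "j - 1"] lo_le_hi[OF k, of "j - 1"] by (auto simp: p_def)
      ultimately consider "j = i" | "j = i + 1" by linarith
      then show ?thesis
      proof cases
        case 1
        then show ?thesis using b2 m lo_eq lo_le_hi[OF k, of i] by (auto simp: p_def)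
      next
        case 2
        have gsub: "{hi (Suc k) (m - 1)<..<hi k i} \<subseteq> gap C (Suc k) m"
          using gap_inner[OF k', of m] lo_eq by (auto simp: p_def)
        obtain j' where "gap C (Suc k) m \<subseteq> C k j' \<or> gap C (Suc k) m \<subseteq> gap C k j'"
          using part_gap[OF k, of m] unfolding part_def by blast
        then show ?thesis
        proof
          assume "gap C (Suc k) m \<subseteq> C k j'"
          then show ?thesis
            using part_left_of_hi(1)[OF k _ gsub] m lo_eq b2 2 by (auto simp: p_def)
        next
          \<comment> \<open>As infimum of bar \<open>m\<close>, the point \<open>p\<close> lies in
            that bar or in the gap before it. Both are inside gaps of level \<open>k\<close>, which
            miss the one-point bar \<open>C k i\<close>.\<close>
          assume g: "gap C (Suc k) m \<subseteq> gap C k j'"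
          then have "lo k i = p" using part_left_of_hi(2)[OF k _ gsub] m by (auto simp: p_def)
          then have pC: "p \<in> C k i" using singleton_bar[OF k] by (auto simp: p_def)
          then have "p \<notin> C (Suc k) m" using sub gap_C_disjoint[OF k] by blast
          then have "p \<in> gap C (Suc k) m"
            unfolding gap_def using m(1) C_bounds[OF k'] lo_eq by (force simp: less_le)
          then have False using g pC gap_C_disjoint[OF k] by blast
          then show ?thesis ..
        qed
      qed
    qed
  qed
  then show ?thesis using m unfolding p_def by blast
qed

lemma gap_subset:
  assumes k: "0 < k" and n: "hi k i \<le> hi (Suc k) n" "hi (Suc k) n < lo k (i + 1)"
  shows "gap C (Suc k) (n + 1) \<subseteq> gap C k (i + 1)" "lo (Suc k) (n + 1) \<le> lo k (i + 1)"
proof -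
  show le: "lo (Suc k) (n + 1) \<le> lo k (i + 1)"
    using no_straddle_gap[OF k n(2), of "i + 1"] by simp
  obtain u where u: "hi (Suc k) n < u" "u < lo (Suc k) (n + 1)"
    using dense hi_less_lo[of "Suc k" n] by blast
  have ug: "u \<in> gap C (Suc k) (n + 1)" using u by (auto intro: gap_inner)
  have u': "u \<in> gap C k (i + 1)" using u n le by (auto intro: gap_inner k)
  obtain j where "gap C (Suc k) (n + 1) \<subseteq> C k j \<or> gap C (Suc k) (n + 1) \<subseteq> gap C k j"
    using part_gap[OF k] unfolding part_def by blast
  then show "gap C (Suc k) (n + 1) \<subseteq> gap C k (i + 1)"
  proof
    assume "gap C (Suc k) (n + 1) \<subseteq> C k j"
    then show ?thesis using gap_C_disjoint[OF k u'] ug by blast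
  next
    assume sub: "gap C (Suc k) (n + 1) \<subseteq> gap C k j"
    then have b: "hi k (j - 1) \<le> u" "u \<le> lo k j" using gap_bounds[OF k] ug by blast+
    have "j - 1 \<le> i"
      using b u n le hi_less_lo'[OF k, of i "j - 1"] lo_mono[OF k, of "i + 1" "j - 1"] lo_le_hi[OF k, of "j - 1"]
      by (cases "j - 1 \<le> i") auto
    moreover have "i < j"
      using b u n lo_mono[OF k, of j i] lo_le_hi[OF k, of i] by (cases "i < j") auto
    ultimately have "j = i + 1" by simp
    then show ?thesis using sub by simp
  qed
qed


section \<open>Friendly systems as towers\<close>

lemma bar_in_gap_bounds:
  assumes k: "0 < k" and "C (Suc k) l \<subseteq> gap C k n"
  shows "hi k (n - 1) \<le> lo (Suc k) l" "hi (Suc k) l \<le> lo k n"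
proof -
  show "hi k (n - 1) \<le> lo (Suc k) l"
    unfolding lo_def[of "Suc k"] using assms gap_bounds[OF k] C_nonempty[of "Suc k"]
    by (intro cInf_greatest) auto
  show "hi (Suc k) l \<le> lo k n"
    unfolding hi_def[of "Suc k"] using assms gap_bounds[OF k] C_nonempty[of "Suc k"]
    by (intro cSup_least) auto
qed

text \<open>This supplies an element of \<open>subgaps C k n\<close>, without which the bar
  inequality of \<open>friendly\<close>, stated under a quantifier over \<open>subgaps\<close>,
  yields nothing.\<close>

lemma subgap_between_bars:
  assumes k: "0 < k" and l: "l < l'" "C (Suc k) l \<subseteq> gap C k n" "C (Suc k) l' \<subseteq> gap C k n"
  shows "gap C (Suc k) (l + 1) \<subseteq> gap C k n"
proof
  fix x assume x: "x \<in> gap C (Suc k) (l + 1)"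
  obtain p where p: "p \<in> C (Suc k) l" using C_nonempty[of "Suc k"] by blast
  obtain q where q: "q \<in> C (Suc k) l'" using C_nonempty[of "Suc k"] by blast
  have "p < x" using x p unfolding gap_def by simp
  moreover have "x < q"
  proof (cases "l' = l + 1")
    case True
    then show ?thesis using x q unfolding gap_def by simp
  next
    case False
    then show ?thesis
      using gap_bounds[OF _ x] C_bounds[OF _ q] lo_le_hi[of "Suc k" "l + 1"] hi_less_lo'[of "Suc k" "l + 1" l'] l(1)
      by simp
  qed
  moreover have "p \<in> gap C k n" "q \<in> gap C k n" using p q l by auto
  ultimately show "x \<in> gap C k n" unfolding gap_def by (auto intro: less_trans)
qed

lemma ex_two_bars:
  assumes "card {m. C (Suc k) m \<subseteq> gap C k n} \<ge> 3"
  obtains l l' where "l < l'" "C (Suc k) l \<subseteq> gap C k n" "C (Suc k) l' \<subseteq> gap C k n"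
proof -
  define M where "M = {m. C (Suc k) m \<subseteq> gap C k n}"
  have "M \<noteq> {}" using assms unfolding M_def by force
  then obtain l where l: "l \<in> M" by blast
  have "M \<noteq> {l}" using assms unfolding M_def[symmetric] by auto
  then obtain l' where l': "l' \<in> M" "l' \<noteq> l" using l by blast
  then show ?thesis using that[of l l'] that[of l' l] l unfolding M_def by (cases l l' rule: linorder_cases) auto
qed

text \<open>Since \<open>gap C k n\<close> lies left of bar \<open>n\<close>, friendliness bounds a
  bar by each of the two gaps to its left. The nearer gap gives \<open>bar_small\<close>; both enter
  into \<open>child\<close>.\<close>

lemma interval_tower:
  fixes \<alpha> \<beta> :: real
  assumes \<alpha>: "0 < \<alpha>" "\<alpha> < 1" and \<beta>: "0 < \<beta>" "\<beta> < 1" and \<gamma>: "0 < gam \<alpha> \<beta>"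
    and three: "\<And>k n. 1 \<le> k \<Longrightarrow> card {m. C (Suc k) m \<subseteq> gap C k n} \<ge> 3"
    and friendly: "\<And>k n D. K < k \<Longrightarrow> D \<in> subgaps C k n \<Longrightarrow>
        len (gap C k n) > 1 / (\<alpha> * \<beta> * gam \<alpha> \<beta>) * max (len (C k n)) (len (C k (n + 1))) \<and>
        len D < (\<alpha> * \<beta>)\<^sup>2 * gam \<alpha> \<beta> / 6 *
          min (len (gap C k (n - 1))) (min (len (gap C k n)) (len (gap C k (n + 1))))"
  shows "interval_tower lo hi K \<alpha> (\<alpha> * \<beta>) (gam \<alpha> \<beta>)"
proof -
  define y where "y = \<alpha> * \<beta>"
  define g where "g = gam \<alpha> \<beta>"
  have y: "0 < y" "y < \<alpha>" using \<alpha> \<beta> by (simp_all add: y_def)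
  have g: "0 < g" "g = 1 + y - 2 * \<alpha>" using \<gamma> by (simp_all add: g_def y_def gam_def)
  have bars: "hi k n - lo k n < y * g * (lo k n - hi k (n - 1))"
      "hi k (n + 1) - lo k (n + 1) < y * g * (lo k n - hi k (n - 1))" if k: "K < k" for k n
  proof -
    have k0: "0 < k" using k by simp
    obtain l l' where "l < l'" "C (Suc k) l \<subseteq> gap C k n" "C (Suc k) l' \<subseteq> gap C k n"
      using ex_two_bars[OF three, of k n] k0 by auto
    then have "gap C (Suc k) (l + 1) \<in> subgaps C k n"
      unfolding subgaps_def using subgap_between_bars[OF k0] by blast
    then have "1 / (y * g) * max (len (C k n)) (len (C k (n + 1))) < len (gap C k n)"
      using friendly[OF k] unfolding y_def g_def by blast
    then have "max (len (C k n)) (len (C k (n + 1))) < y * g * len (gap C k n)"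
      using mult_pos_pos[OF y(1) g(1)] by (simp add: pos_divide_less_eq mult.commute del: max_less_iff_conj)
    then show "hi k n - lo k n < y * g * (lo k n - hi k (n - 1))"
      "hi k (n + 1) - lo k (n + 1) < y * g * (lo k n - hi k (n - 1))"
      by (simp_all add: len_C[OF k0] len_gap[OF k0])
  qed
  have subgap: "lo (Suc k) (n + 1) \<le> lo k (i + 1) \<and>
      lo (Suc k) (n + 1) - hi (Suc k) n < y\<^sup>2 * g / 6 * (lo k i - hi k (i - 1)) \<and>
      lo (Suc k) (n + 1) - hi (Suc k) n < y\<^sup>2 * g / 6 * (lo k (i + 1) - hi k i) \<and>
      lo (Suc k) (n + 1) - hi (Suc k) n < y\<^sup>2 * g / 6 * (lo k (i + 2) - hi k (i + 1))"
    if k: "K < k" and n: "hi k i \<le> hi (Suc k) n" "hi (Suc k) n < lo k (i + 1)" for k i n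
  proof -
    have k0: "0 < k" using k by simp
    have "gap C (Suc k) (n + 1) \<in> subgaps C k (i + 1)"
      unfolding subgaps_def using gap_subset(1)[OF k0 n] by blast
    then have "len (gap C (Suc k) (n + 1)) < y\<^sup>2 * g / 6 *
        min (len (gap C k i)) (min (len (gap C k (i + 1))) (len (gap C k (i + 2))))"
      using friendly[OF k] unfolding y_def g_def by (force simp: add.assoc)
    moreover have "0 \<le> y\<^sup>2 * g / 6" using g by simp
    ultimately have *: "len (gap C (Suc k) (n + 1)) < y\<^sup>2 * g / 6 * q"
      if "min (len (gap C k i)) (min (len (gap C k (i + 1))) (len (gap C k (i + 2)))) \<le> q" for q
      using mult_left_mono[OF that] by (meson less_le_trans)
    have "len (gap C (Suc k) (n + 1)) < y\<^sup>2 * g / 6 * len (gap C k i)"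
      "len (gap C (Suc k) (n + 1)) < y\<^sup>2 * g / 6 * len (gap C k (i + 1))"
      "len (gap C (Suc k) (n + 1)) < y\<^sup>2 * g / 6 * len (gap C k (i + 2))"
      by (rule *; simp add: min_le_iff_disj)+
    moreover have "i + 2 - 1 = i + 1" by simp
    ultimately show ?thesis
      using gap_subset(2)[OF k0 n] unfolding len_gap[OF k0] len_gap[OF zero_less_Suc] by simp
  qed
  have child: "\<exists>m. hi k i \<le> hi (Suc k) m \<and> hi (Suc k) m < lo k (i + 1) \<and>
      ((lo k i \<le> lo (Suc k) m \<and> hi (Suc k) m = hi k i) \<or>
       (lo (Suc k) m = hi k i \<and>
        hi (Suc k) m - lo (Suc k) m \<le> y * g * (hi k i - lo k i) \<and>
        (hi (Suc k) m - lo (Suc k) m \<le> y * g / 2 * (hi k i - lo k i) \<or>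
         (\<forall>t\<in>{i - 1, i}. hi (Suc k) m - lo (Suc k) m
            \<le> y * g * (y\<^sup>2 * g / 6 * (lo k (t + 1) - hi k t))))))"
    if k: "K < k" for k i
  proof -
    have k0: "0 < k" and k': "0 < Suc k" and kS: "K < Suc k" using k by simp_all
    obtain m where m: "hi (Suc k) (m - 1) < hi k i" "hi k i \<le> hi (Suc k) m"
      and cases: "lo k i \<le> lo (Suc k) m \<and> hi (Suc k) m = hi k i \<or>
        lo (Suc k) m = hi k i \<and> lo k i \<le> hi (Suc k) (m - 1) \<and> hi (Suc k) m \<le> lo k (i + 1)"
      using child_exists[OF k0] by blast
    from cases show ?thesis
    proof
      assume "lo k i \<le> lo (Suc k) m \<and> hi (Suc k) m = hi k i"
      then show ?thesis using hi_less_lo[OF k0, of i] by (intro exI[of _ m]) auto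
    next
      assume poke: "lo (Suc k) m = hi k i \<and> lo k i \<le> hi (Suc k) (m - 1) \<and> hi (Suc k) m \<le> lo k (i + 1)"
      define b where "b = hi (Suc k) m - lo (Suc k) m"
      have yg: "0 < y * g" using y g by simp
      have b1: "b < y * g * (lo (Suc k) m - hi (Suc k) (m - 1))"
        using bars(1)[OF kS, of m] by (simp add: b_def)
      have b2: "b < y * g * (lo (Suc k) (m - 1) - hi (Suc k) (m - 2))"
        using bars(2)[OF kS, of "m - 1"] by (simp add: b_def)
      have "y * g * (lo (Suc k) m - hi (Suc k) (m - 1)) \<le> y * g * (hi k i - lo k i)"
        using poke yg by (intro mult_left_mono) auto
      then have b3: "b \<le> y * g * (hi k i - lo k i)" using b1 by simp
      \<comment> \<open>An abutting bar reaching \<open>lo k (i + 1)\<close> would fill the gap and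
        be the only bar in it.\<close>
      have less: "hi (Suc k) m < lo k (i + 1)"
      proof (rule ccontr)
        assume "\<not> ?thesis"
        then have eq: "hi (Suc k) m = lo k (i + 1)" using poke by simp
        obtain l l' where l: "l < l'" "C (Suc k) l \<subseteq> gap C k (i + 1)" "C (Suc k) l' \<subseteq> gap C k (i + 1)"
          using ex_two_bars[OF three, of k "i + 1"] k0 by auto
        have "j = m" if "C (Suc k) j \<subseteq> gap C k (i + 1)" for j
          using bar_in_gap_bounds[OF k0 that] eq poke hi_less_lo'[OF k', of j m] hi_less_lo'[OF k', of m j]
            lo_le_hi[OF k', of j]
          by (cases j m rule: linorder_cases) auto
        then show False using l by blast
      qed
      \<comment> \<open>If both left gaps of bar \<open>m\<close> lie in bar \<open>i\<close>,
        adding the two bounds gives the factor 1/2. Otherwise the farther gap is a subgap of the gap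
        before bar \<open>i\<close> and inherits its bounds.\<close>
      have "b \<le> y * g / 2 * (hi k i - lo k i) \<or>
         (\<forall>t\<in>{i - 1, i}. b \<le> y * g * (y\<^sup>2 * g / 6 * (lo k (t + 1) - hi k t)))"
      proof (cases "lo k i \<le> hi (Suc k) (m - 2)")
        case True
        have "2 * b \<le> y * g * ((lo (Suc k) m - hi (Suc k) (m - 1)) + (lo (Suc k) (m - 1) - hi (Suc k) (m - 2)))"
          using b1 b2 by (simp add: algebra_simps)
        also have "\<dots> \<le> y * g * (hi k i - lo k i)"
          using True poke lo_le_hi[OF k', of "m - 1"] yg by (intro mult_left_mono) auto
        finally show ?thesis by simp
      next
        case False
        \<comment> \<open>If bar \<open>m - 2\<close> ended before \<open>hi k (i - 1)\<close>, only
          bar \<open>m - 1\<close> could lie in \<open>gap C k i\<close>, because bar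
          \<open>m\<close> starts at \<open>hi k i\<close>.\<close>
        have "hi k (i - 1) \<le> hi (Suc k) (m - 2)"
        proof (rule ccontr)
          assume a: "\<not> ?thesis"
          obtain l l' where l: "l < l'" "C (Suc k) l \<subseteq> gap C k i" "C (Suc k) l' \<subseteq> gap C k i"
            using ex_two_bars[OF three, of k i] k0 by auto
          have "m - 1 \<le> l"
            using bar_in_gap_bounds[OF k0 l(2)] a hi_mono[OF k', of l "m - 2"] lo_le_hi[OF k', of l]
            by (cases "m - 1 \<le> l") auto
          then have "lo (Suc k) m \<le> lo (Suc k) l'" using l(1) by (intro lo_mono[OF k']) auto
          then show False
            using bar_in_gap_bounds[OF k0 l(3)] poke m lo_le_hi[OF k', of l'] by linarith
        qed
        then have "lo (Suc k) (m - 1) - hi (Suc k) (m - 2) < y\<^sup>2 * g / 6 * (lo k i - hi k (i - 1))"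
          "lo (Suc k) (m - 1) - hi (Suc k) (m - 2) < y\<^sup>2 * g / 6 * (lo k (i + 1) - hi k i)"
          using subgap[OF k, of "i - 1" "m - 2"] False by (simp_all add: add.commute)
        then have "y * g * (lo (Suc k) (m - 1) - hi (Suc k) (m - 2)) \<le> y * g * (y\<^sup>2 * g / 6 * (lo k (t + 1) - hi k t))"
          if "t \<in> {i - 1, i}" for t
          using that yg by (intro mult_left_mono) auto
        then show ?thesis using b2 by force
      qed
      then show ?thesis
        using m(2) less poke b3 unfolding b_def by (intro exI[of _ m]) blast
    qed
  qed
  have "interval_tower lo hi K \<alpha> y g"
    using y \<alpha> g bars(1) subgap child lo_le_hi hi_less_lo finite_lo
    by unfold_locales auto
  then show ?thesis unfolding y_def g_def .
qed

end

section \<open>Strategies from invariants\<close>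

primrec history_state ::
  "(ball \<Rightarrow> 's) \<Rightarrow> ('s \<Rightarrow> ball \<Rightarrow> ball \<Rightarrow> 's) \<Rightarrow> (nat \<Rightarrow> ball) \<Rightarrow> nat \<Rightarrow> 's" where
  "history_state h u B 0 = h (B 0)"
| "history_state h u B (Suc n) = u (history_state h u B n) (B n) (B (Suc n))"

lemma history_state_cong:
  "(\<And>i. i \<le> n \<Longrightarrow> B i = B' i) \<Longrightarrow> history_state h u B n = history_state h u B' n"
  by (induction n) auto

text \<open>A strategy sees only Bob's moves, so Alice's state is recomputed from the whole history
  through fixed choice functions \<open>h\<close> and \<open>u\<close>; \<open>J\<close> is required
  of the initial state alone.\<close>

lemma winning_by_invariant:
  fixes Inv :: "'s \<Rightarrow> ball \<Rightarrow> bool"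
  assumes init: "\<And>P. 0 < snd P \<Longrightarrow> \<exists>s. Inv s P \<and> J s"
    and step: "\<And>s P. Inv s P \<Longrightarrow> \<exists>A. legal_move \<alpha> P A \<and>
        (\<forall>Q. legal_move \<beta> A Q \<longrightarrow> (\<exists>s'. Inv s' Q \<and> Tr s P s' Q))"
    and win: "\<And>B s x. 0 < snd (B 0) \<Longrightarrow> J (s 0) \<Longrightarrow> (\<And>n::nat. Inv (s n) (B n)) \<Longrightarrow>
        (\<And>n. Tr (s n) (B n) (s (Suc n)) (B (Suc n))) \<Longrightarrow>
        (\<And>n. snd (B (Suc n)) = \<beta> * (\<alpha> * snd (B n))) \<Longrightarrow>
        (\<And>n. x \<in> interval_of (B n)) \<Longrightarrow> x \<in> T"
  shows "winning \<alpha> \<beta> T"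
proof -
  obtain h where h: "\<And>P. 0 < snd P \<Longrightarrow> Inv (h P) P \<and> J (h P)" using init by metis
  obtain f u where fu: "\<And>s P. Inv s P \<Longrightarrow> legal_move \<alpha> P (f s P)"
    "\<And>s P Q. Inv s P \<Longrightarrow> legal_move \<beta> (f s P) Q \<Longrightarrow> Inv (u s P Q) Q \<and> Tr s P (u s P Q) Q"
    using step by metis
  define \<sigma> where "\<sigma> xs = f (history_state h u (\<lambda>i. xs ! i) (length xs - 1)) (last xs)" for xs
  have move: "alice_move \<sigma> B n = f (history_state h u B n) (B n)" for B n
  proof -
    have "history_state h u (\<lambda>i. map B [0..<Suc n] ! i) n = history_state h u B n"
      by (rule history_state_cong) (simp del: upt_Suc)
    then show ?thesis unfolding alice_move_def \<sigma>_def by simp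
  qed
  have inv: "Inv (history_state h u B n) (B n)" if "bob_legal_upto \<beta> \<sigma> B n" for B n
    using that
  proof (induction n)
    case 0
    then show ?case using h by (simp add: bob_legal_upto_def)
  next
    case (Suc n)
    then have "bob_legal_upto \<beta> \<sigma> B n" by (simp add: bob_legal_upto_def)
    then show ?case using Suc fu(2) by (simp add: bob_legal_upto_def move)
  qed
  show ?thesis
    unfolding winning_def
  proof (intro exI[of _ \<sigma>] conjI allI impI subsetI)
    fix B n assume "bob_legal_upto \<beta> \<sigma> B n"
    then show "legal_move \<alpha> (B n) (alice_move \<sigma> B n)" using inv fu(1) move by simp
  next
    fix B x assume legal: "\<forall>n. bob_legal_upto \<beta> \<sigma> B n" and x: "x \<in> (\<Inter>n. interval_of (B n))"
    have bob: "legal_move \<beta> (f (history_state h u B n) (B n)) (B (Suc n))" for n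
      using legal[rule_format, of "Suc n"] by (simp add: bob_legal_upto_def move)
    have pos: "0 < snd (B 0)" using legal by (simp add: bob_legal_upto_def)
    show "x \<in> T"
    proof (rule win[of B "history_state h u B" x])
      show "Tr (history_state h u B n) (B n) (history_state h u B (Suc n)) (B (Suc n))" for n
        using fu(2)[OF inv bob] legal by simp
      show "snd (B (Suc n)) = \<beta> * (\<alpha> * snd (B n))" for n
        using bob[of n] fu(1)[OF inv, of B n] legal by (simp add: legal_move_def)
    qed (use pos h inv legal x in auto)
  qed
qed

lemma legal_move_iff:
  assumes "0 < snd P" "0 < t"
  shows "legal_move t P Q \<longleftrightarrow> snd Q = t * snd P \<and> \<bar>fst Q - fst P\<bar> \<le> (1 - t) * snd P"
proof -
  have "\<not> t * snd P < 0" using assms by (simp add: not_less)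
  then show ?thesis
    unfolding legal_move_def interval_of_def
    by (auto simp: cball_subset_cball_iff dist_real_def algebra_simps)
qed

theorem theorem1p10:
  fixes \<alpha> \<beta> :: real and C :: interval_system
  assumes "0 < \<alpha>" and "\<alpha> < 1" and "0 < \<beta>" and "\<beta> < 1"
    and "gam \<alpha> \<beta> > 0"
    and "admissible_system C"
    and "friendly \<alpha> \<beta> C"
  shows "winning \<alpha> \<beta> (finitely_often C)"
proof -
  interpret admissible_intervals C by standard fact
  obtain K where three: "\<And>k n. 1 \<le> k \<Longrightarrow> card {m. C (Suc k) m \<subseteq> gap C k n} \<ge> 3"
    and friendly: "\<And>k n D. K < k \<Longrightarrow> D \<in> subgaps C k n \<Longrightarrow>
        len (gap C k n) > 1 / (\<alpha> * \<beta> * gam \<alpha> \<beta>) * max (len (C k n)) (len (C k (n + 1))) \<and>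
        len D < (\<alpha> * \<beta>)\<^sup>2 * gam \<alpha> \<beta> / 6 *
          min (len (gap C k (n - 1))) (min (len (gap C k n)) (len (gap C k (n + 1))))"
    using assms(7) unfolding friendly_def by metis
  define y where "y = \<alpha> * \<beta>"
  interpret tower: interval_tower lo hi K \<alpha> y "gam \<alpha> \<beta>"
    unfolding y_def using interval_tower[OF assms(1-5) three friendly] .
  show ?thesis
  \<comment> \<open>The state is the pair of stage \<open>N\<close> and bound \<open>v\<close>. By
    \<open>J\<close> the first stage is some \<open>2 * k0\<close>, and every level from
    \<open>k0\<close> on is eventually settled.\<close>
  proof (rule winning_by_invariant[where
        Inv = "\<lambda>s P. tower.Inv (fst s) (snd s) (fst P) (snd P)" and
        Tr = "\<lambda>s P s' Q. tower.Tr (fst s) (snd s) (fst P) (snd P) (fst s') (snd s') (fst Q)" and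
        J = "\<lambda>s. even (fst s)"])
    fix P :: ball assume "0 < snd P"
    then obtain k v where "tower.Inv (2 * k) v (fst P) (snd P)"
      using tower.initial_Inv[OF dense_gaps] by blast
    then show "\<exists>s. tower.Inv (fst s) (snd s) (fst P) (snd P) \<and> even (fst s)"
      by (intro exI[of _ "(2 * k, v)"]) simp
  next
    fix s :: "nat \<times> real" and P :: ball
    assume inv: "tower.Inv (fst s) (snd s) (fst P) (snd P)"
    define r where "r = snd P"
    have r: "0 < r" using inv by (simp add: tower.Inv_def r_def)
    obtain p where p: "\<bar>p - fst P\<bar> \<le> (1 - \<alpha>) * r"
      and reply: "\<And>c'. \<bar>c' - p\<bar> \<le> (\<alpha> - y) * r \<Longrightarrow> tower.reply (fst s) (snd s) (fst P) r c'"
      using tower.step[OF inv] unfolding tower.forces_def r_def by blast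
    show "\<exists>A. legal_move \<alpha> P A \<and> (\<forall>Q. legal_move \<beta> A Q \<longrightarrow> (\<exists>s'.
        tower.Inv (fst s') (snd s') (fst Q) (snd Q) \<and>
        tower.Tr (fst s) (snd s) (fst P) (snd P) (fst s') (snd s') (fst Q)))"
    proof (intro exI[of _ "(p, \<alpha> * r)"] conjI allI impI)
      show "legal_move \<alpha> P (p, \<alpha> * r)" using p r assms(1) by (simp add: legal_move_iff r_def)
      fix Q assume "legal_move \<beta> (p, \<alpha> * r) Q"
      then have Q: "snd Q = y * r" "\<bar>fst Q - p\<bar> \<le> (\<alpha> - y) * r"
        using r assms(1,3) by (simp_all add: legal_move_iff y_def algebra_simps)
      then obtain N' v' where "tower.Inv N' v' (fst Q) (y * r)" "tower.Tr (fst s) (snd s) (fst P) r N' v' (fst Q)"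
        using reply unfolding tower.reply_def by blast
      then show "\<exists>s'. tower.Inv (fst s') (snd s') (fst Q) (snd Q) \<and>
          tower.Tr (fst s) (snd s) (fst P) (snd P) (fst s') (snd s') (fst Q)"
        using Q(1) by (intro exI[of _ "(N', v')"]) (simp add: r_def)
    qed
  next
    fix B :: "nat \<Rightarrow> ball" and s :: "nat \<Rightarrow> nat \<times> real" and x
    assume pos: "0 < snd (B 0)" and even: "even (fst (s 0))"
      and inv: "\<And>n. tower.Inv (fst (s n)) (snd (s n)) (fst (B n)) (snd (B n))"
      and tr: "\<And>n. tower.Tr (fst (s n)) (snd (s n)) (fst (B n)) (snd (B n))
          (fst (s (Suc n))) (snd (s (Suc n))) (fst (B (Suc n)))"
      and shrink: "\<And>n. snd (B (Suc n)) = \<beta> * (\<alpha> * snd (B n))"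
      and x: "\<And>n. x \<in> interval_of (B n)"
    have r: "snd (B n) = y ^ n * snd (B 0)" for n
      by (induction n) (simp_all add: shrink y_def)
    obtain k0 where k0: "fst (s 0) = 2 * k0" using even by blast
    have "x \<notin> C k l" if k: "1 \<le> k" "k0 \<le> k" for k l
    proof
      assume "x \<in> C k l"
      then have "lo k l \<le> x" "x \<le> hi k l" using C_bounds k by auto
      moreover have "x < lo k l \<or> hi k l < x"
      proof (rule tower.limit_point[of "snd (B 0)" "\<lambda>n. fst (s n)" "\<lambda>n. snd (s n)" "\<lambda>n. fst (B n)"])
        show "\<bar>x - fst (B n)\<bar> \<le> y ^ n * snd (B 0)" for n
          using x[of n] unfolding r[of n, symmetric]
          by (simp add: interval_of_def dist_real_def abs_minus_commute)
        show "tower.Inv (fst (s n)) (snd (s n)) (fst (B n)) (y ^ n * snd (B 0))" for n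
          using inv[of n] unfolding r[of n] .
        show "tower.Tr (fst (s n)) (snd (s n)) (fst (B n)) (y ^ n * snd (B 0))
            (fst (s (Suc n))) (snd (s (Suc n))) (fst (B (Suc n)))" for n
          using tr[of n] unfolding r[of n] .
      qed (use pos k k0 in auto)
      ultimately show False by linarith
    qed
    then have "{k. 1 \<le> k \<and> x \<in> (\<Union>n. C k n)} \<subseteq> {..<k0}" by (auto simp: not_le[symmetric])
    then show "x \<in> finitely_often C"
      unfolding finitely_often_def using finite_subset by blast
  qed
qed

end
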